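(* Let $n\ge1$, let $\mu$ be a partition of length $\ell(\mu)\leq n$, let $\delta=(n,n-1,\ldots,1)$ and $\lambda=\mu+\delta$ (a strict partition of length $n$). Then for all (nonzero) ${\bf x}=(x_1,\ldots,x_n)$ and ${\bf y}=(y_1,\ldots,y_n)$, \[ ST_{\lambda}({\bf x}/{\bf y})=\prod_{1\leq i\leq j\leq n}(x_i+y_j)\bigl(1+x_i^{-1}y_j^{-1}\bigr)\; sp_\mu({\bf x}), \] where $ST_\lambda({\bf x}/{\bf y})=\sum_{ST}\prod_{(i,j)\in SF^\lambda}\mathrm{wgt}(s_{ij})$, the sum being over all symplectic shifted tableaux $ST=(s_{ij})$ of shape $\lambda$, and the weight of the entry $s_{ij}$ at position $(i,j)$ is: if $s_{ij}=k$, then $\mathrm{wgt}(s_{ij})=x_k$ if $s_{i,j-1}=k$, $=y_k$ if $s_{i+1,j}=k$, and $=x_k+y_k$ otherwise; if $s_{ij}=\overline{k}$, then $\mathrm{wgt}(s_{ij})=x_k^{-1}$ if $s_{i,j-1}=\overline{k}$, $=y_k^{-1}$ if $s_{i+1,j}=\overline{k}$, and $=x_k^{-1}+y_k^{-1}$ otherwise.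
   Context: Let $I=\{1<\overline{1}<2<\overline{2}<\cdots<n<\overline{n}\}$ be a totally ordered alphabet. Symplectic character: for a partition $\mu$ with $\ell(\mu)\le n$, a symplectic tableau of shape $\mu$ is a filling of the Young diagram of $\mu$ (English convention) with entries from $I$ weakly increasing along rows, strictly increasing down columns, and with every entry in row $r$ being $\geq r$ in the order of $I$ (i.e. $k$ and $\overline{k}$ appear no lower than row $k$). Then $sp_\mu({\bf x})=\sum_T\prod_{\text{entries}}\mathrm{wgt}$ over all such $T$, where $k$ has weight $x_k$ and $\overline{k}$ has weight $x_k^{-1}$. Symplectic shifted tableaux: for a strict partition $\lambda=(\lambda_1>\cdots>\lambda_n>0)$, $SF^\lambda$ is the set of boxes $(i,j)$, $1\le i\le n$, $i\le j\le i+\lambda_i-1$ ($i$ = row, $j$ = column). A symplectic shifted tableau of shape $\lambda$ is a filling $(s_{ij})$ of $SF^\lambda$ with entries from $I$ that is weakly increasing along each row, weakly increasing down each column, strictly increasing along each diagonal ($s_{ij}<s_{i+1,j+1}$ when both boxes exist), and whose first entry $s_{kk}$ in row $k$ is $k$ or $\overline{k}$ for each $k$. In the weight rule, a condition such as $s_{i,j-1}=k$ is false if the box $(i,j-1)$ is not in $SF^\lambda$. *)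

theory Defs
  imports Complex_Main "HOL-Library.FuncSet"
begin

datatype letter = Plain nat | Bar nat

text \<open>The order on letters is \<open>Plain 1 < Bar 1 < Plain 2 < Bar 2 < \<dots>\<close>.\<close>

fun letter_rank :: "letter \<Rightarrow> nat" where
  "letter_rank (Plain k) = 2 * k"
| "letter_rank (Bar k) = 2 * k + 1"

lemma letter_rank_inject: "letter_rank a = letter_rank b \<longleftrightarrow> a = b"
  by (cases a; cases b) (simp_all, presburger+)

instantiation letter :: linorder
begin

definition less_eq_letter :: "letter \<Rightarrow> letter \<Rightarrow> bool" where
  "a \<le> b \<longleftrightarrow> letter_rank a \<le> letter_rank b"

definition less_letter :: "letter \<Rightarrow> letter \<Rightarrow> bool" where
  "a < b \<longleftrightarrow> letter_rank a < letter_rank b"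

instance
  by standard (auto simp: less_eq_letter_def less_letter_def letter_rank_inject[symmetric])

end

definition alphabet :: "nat \<Rightarrow> letter set" where
  "alphabet n = Plain ` {1..n} \<union> Bar ` {1..n}"

text \<open>A partition is a function \<open>\<mu>\<close> whose parts are the values \<open>\<mu> 1, \<mu> 2, \<dots>\<close>;
  the value \<open>\<mu> 0\<close> is never used.\<close>

definition is_partition :: "(nat \<Rightarrow> nat) \<Rightarrow> bool" where
  "is_partition \<mu> \<longleftrightarrow> (\<forall>i\<ge>1. \<mu> (i + 1) \<le> \<mu> i) \<and> finite {i. 1 \<le> i \<and> \<mu> i > 0}"

definition partition_length :: "(nat \<Rightarrow> nat) \<Rightarrow> nat" where
  "partition_length \<mu> = card {i. 1 \<le> i \<and> \<mu> i > 0}"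

definition staircase :: "nat \<Rightarrow> nat \<Rightarrow> nat" where
  "staircase n i = (if 1 \<le> i \<and> i \<le> n then n + 1 - i else 0)"

text \<open>Boxes are pairs (row, column), both counted from 1.  Fillings of a diagram are
  extensional functions on it, so that a filling is determined by its entries.\<close>

definition young_diagram :: "(nat \<Rightarrow> nat) \<Rightarrow> (nat \<times> nat) set" where
  "young_diagram \<mu> = {(i, j). 1 \<le> i \<and> 1 \<le> j \<and> j \<le> \<mu> i}"

definition symplectic_tableaux :: "nat \<Rightarrow> (nat \<Rightarrow> nat) \<Rightarrow> (nat \<times> nat \<Rightarrow> letter) set" where
  "symplectic_tableaux n \<mu> =
    {T \<in> young_diagram \<mu> \<rightarrow>\<^sub>E alphabet n.
       (\<forall>i j. (i, j) \<in> young_diagram \<mu> \<and> (i, j + 1) \<in> young_diagram \<mu>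
          \<longrightarrow> T (i, j) \<le> T (i, j + 1)) \<and>
       (\<forall>i j. (i, j) \<in> young_diagram \<mu> \<and> (i + 1, j) \<in> young_diagram \<mu>
          \<longrightarrow> T (i, j) < T (i + 1, j)) \<and>
       (\<forall>(r, j) \<in> young_diagram \<mu>. Plain r \<le> T (r, j))}"

fun letter_weight :: "(nat \<Rightarrow> 'a::field) \<Rightarrow> letter \<Rightarrow> 'a" where
  "letter_weight x (Plain k) = x k"
| "letter_weight x (Bar k) = inverse (x k)"

definition symplectic_character :: "nat \<Rightarrow> (nat \<Rightarrow> nat) \<Rightarrow> (nat \<Rightarrow> 'a::field) \<Rightarrow> 'a" where
  "symplectic_character n \<mu> x =
    (\<Sum>T\<in>symplectic_tableaux n \<mu>. \<Prod>b\<in>young_diagram \<mu>. letter_weight x (T b))"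

definition shifted_diagram :: "nat \<Rightarrow> (nat \<Rightarrow> nat) \<Rightarrow> (nat \<times> nat) set" where
  "shifted_diagram n la = {(i, j). 1 \<le> i \<and> i \<le> n \<and> i \<le> j \<and> j \<le> i + la i - 1}"

definition symplectic_shifted_tableaux ::
    "nat \<Rightarrow> (nat \<Rightarrow> nat) \<Rightarrow> (nat \<times> nat \<Rightarrow> letter) set" where
  "symplectic_shifted_tableaux n la =
    {s \<in> shifted_diagram n la \<rightarrow>\<^sub>E alphabet n.
       (\<forall>i j. (i, j) \<in> shifted_diagram n la \<and> (i, j + 1) \<in> shifted_diagram n la
          \<longrightarrow> s (i, j) \<le> s (i, j + 1)) \<and>
       (\<forall>i j. (i, j) \<in> shifted_diagram n la \<and> (i + 1, j) \<in> shifted_diagram n la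
          \<longrightarrow> s (i, j) \<le> s (i + 1, j)) \<and>
       (\<forall>i j. (i, j) \<in> shifted_diagram n la \<and> (i + 1, j + 1) \<in> shifted_diagram n la
          \<longrightarrow> s (i, j) < s (i + 1, j + 1)) \<and>
       (\<forall>k\<in>{1..n}. s (k, k) = Plain k \<or> s (k, k) = Bar k)}"

text \<open>On a symplectic shifted tableau the first two cases below exclude each other, since
  \<open>s (i, j - 1) < s (i + 1, j)\<close> along diagonals; the order of the tests is immaterial.
  The truncated \<open>j - 1\<close> is harmless, as boxes have \<open>j \<ge> 1\<close> and no box has column 0.\<close>

definition entry_weight ::
    "(nat \<times> nat) set \<Rightarrow> (nat \<Rightarrow> 'a::field) \<Rightarrow> (nat \<Rightarrow> 'a) \<Rightarrow> (nat \<times> nat \<Rightarrow> letter)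
      \<Rightarrow> nat \<times> nat \<Rightarrow> 'a" where
  "entry_weight D x y s = (\<lambda>(i, j).
     if (i, j - 1) \<in> D \<and> s (i, j - 1) = s (i, j) then letter_weight x (s (i, j))
     else if (i + 1, j) \<in> D \<and> s (i + 1, j) = s (i, j) then letter_weight y (s (i, j))
     else letter_weight x (s (i, j)) + letter_weight y (s (i, j)))"

definition shifted_tableaux_sum ::
    "nat \<Rightarrow> (nat \<Rightarrow> nat) \<Rightarrow> (nat \<Rightarrow> 'a::field) \<Rightarrow> (nat \<Rightarrow> 'a) \<Rightarrow> 'a" where
  "shifted_tableaux_sum n la x y =
    (\<Sum>s\<in>symplectic_shifted_tableaux n la.
       \<Prod>b\<in>shifted_diagram n la. entry_weight (shifted_diagram n la) x y s b)"

end

theory Submission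
  imports Defs "HOL-Computational_Algebra.Formal_Power_Series" "Jordan_Normal_Form.Determinant"
begin

text \<open>
  Both sides are built up one letter at a time. The cells holding the largest letter form a strip, and
  summing over all such strips acts on determinants \<open>det (F\<^sub>j $ \<lambda>\<^sub>i)\<close> of coefficients of power series
  by multiplying every \<open>F\<^sub>j\<close> by \<open>(1 + b X) / (1 - a X)\<close>, where \<open>a\<close> and \<open>b\<close> are the \<open>x\<close>- and \<open>y\<close>-weights
  of the letter: subtracting a multiple of the next row from each row makes the entries sums over
  interlacing parts, and multilinearity does the rest. Ordinary tableaux are the case \<open>b = 0\<close>, in
  the coordinates \<open>\<lambda> = \<mu> + \<delta>\<close>.

  Put \<open>u = X + 1/X\<close>, \<open>X\<^sub>k = x\<^sub>k + 1/x\<^sub>k\<close> and \<open>Y\<^sub>k = y\<^sub>k + 1/y\<^sub>k\<close>. The symplectic character is then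
  \<open>det (N\<^sub>j $ \<lambda>\<^sub>i)\<close>, where \<open>N\<^sub>j\<close> is the product of \<open>1/(u - X\<^sub>k)\<close> over \<open>j \<le> k \<le> n\<close>. For shifted tableaux the
  letters of index \<open>n\<close> multiply the columns of level \<open>n - 1\<close> by \<open>(u + Y\<^sub>n)/(u - X\<^sub>n)\<close>, which gives
  \<open>(u + Y\<^sub>n) N\<^sub>j = N\<^sub>j\<^sub>+\<^sub>1 + (X\<^sub>j + Y\<^sub>n) N\<^sub>j\<close>. This change of columns is triangular with determinant
  \<open>\<Prod>\<^sub>j (X\<^sub>j + Y\<^sub>n)\<close>, and \<open>X\<^sub>j + Y\<^sub>n = (x\<^sub>j + y\<^sub>n) (1 + 1/(x\<^sub>j y\<^sub>n))\<close>.
\<close>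

section \<open>Removing the largest letter\<close>

text \<open>The premise \<open>0 < l i\<close> allows a strict partition to be continued by
  zeros.\<close>

definition strict_shape :: "(nat \<Rightarrow> nat) \<Rightarrow> bool" where
  "strict_shape l \<longleftrightarrow> (\<forall>i. 0 < l i \<longrightarrow> l (Suc i) < l i)"

text \<open>The shapes \<open>v\<close> for which \<open>l / v\<close> is a horizontal strip: no two
  of its cells share a position \<open>d\<close>. This is what strictness in \<open>d\<close>
  demands of cells holding one and the same letter.\<close>

definition interlacing :: "(nat \<Rightarrow> nat) \<Rightarrow> (nat \<Rightarrow> nat) set" where
  "interlacing l = {v. \<forall>i. l (Suc i) \<le> v i \<and> v i \<le> l i}"

text \<open>Rows and positions in a row are counted from 0, entries are ranks of letters, and cells outside
  the shape \<open>l\<close> hold 0. Position \<open>d\<close> is column \<open>d + 1\<close> of a Young diagram, but the cell \<open>d\<close> steps to the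
  right of the main diagonal of a shifted diagram. In these coordinates the strictness along columns
  and the strictness along diagonals become the same condition; the flag \<open>b\<close> adds the weak increase down
  the columns of a shifted diagram, which forces all intermediate shapes to be strict partitions.\<close>

definition fillings ::
    "bool \<Rightarrow> (nat \<Rightarrow> nat \<Rightarrow> nat \<Rightarrow> bool) \<Rightarrow> nat \<Rightarrow> (nat \<Rightarrow> nat) \<Rightarrow> (nat \<Rightarrow> nat \<Rightarrow> nat) set" where
  "fillings b Q m l = {T.
     (\<forall>i d. d < l i \<longrightarrow> T i d \<le> m \<and> Q i d (T i d)) \<and>
     (\<forall>i d. \<not> d < l i \<longrightarrow> T i d = 0) \<and>
     (\<forall>i d. Suc d < l i \<longrightarrow> T i d \<le> T i (Suc d)) \<and>
     (\<forall>i d. d < l (Suc i) \<longrightarrow> T i d < T (Suc i) d) \<and>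
     (b \<longrightarrow> (\<forall>i d. Suc d < l i \<and> d < l (Suc i) \<longrightarrow> T i (Suc d) \<le> T (Suc i) d))}"

text \<open>In the shifted coordinates the box below \<open>(i, d)\<close> is \<open>(Suc i, d - 1)\<close>.\<close>

definition cell_weight ::
    "(nat \<Rightarrow> 'a::comm_ring_1) \<Rightarrow> (nat \<Rightarrow> 'a) \<Rightarrow> (nat \<Rightarrow> 'a) \<Rightarrow> (nat \<Rightarrow> nat) \<Rightarrow> (nat \<Rightarrow> nat \<Rightarrow> nat)
      \<Rightarrow> nat \<Rightarrow> nat \<Rightarrow> 'a" where
  "cell_weight \<alpha> \<beta> \<gamma> l T i d =
     (if 0 < d \<and> T i (d - 1) = T i d then \<alpha> (T i d)
      else if 0 < d \<and> d - 1 < l (Suc i) \<and> T (Suc i) (d - 1) = T i d then \<beta> (T i d)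
      else \<gamma> (T i d))"

definition filling_sum ::
    "(nat \<Rightarrow> 'a::comm_ring_1) \<Rightarrow> (nat \<Rightarrow> 'a) \<Rightarrow> (nat \<Rightarrow> 'a) \<Rightarrow> bool \<Rightarrow>
      (nat \<Rightarrow> nat \<Rightarrow> nat \<Rightarrow> bool) \<Rightarrow> nat \<Rightarrow> nat \<Rightarrow> (nat \<Rightarrow> nat) \<Rightarrow> 'a" where
  "filling_sum \<alpha> \<beta> \<gamma> b Q n m l =
     (\<Sum>T\<in>fillings b Q m l. \<Prod>i<n. \<Prod>d<l i. cell_weight \<alpha> \<beta> \<gamma> l T i d)"

text \<open>Total weight of the strip cells of row \<open>i\<close>, which start at position
  \<open>v i\<close>. The first one gets \<open>b\<close> when the box below it, cell
  \<open>(Suc i, v i - 1)\<close>, lies in the strip too: it is in \<open>l\<close> only if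
  \<open>v i = l (Suc i)\<close>, given interlacing, and outside \<open>v\<close> only if
  \<open>v (Suc i) < v i\<close>. Every later cell has an equal left neighbour.\<close>

definition row_weight :: "'a::comm_ring_1 \<Rightarrow> 'a \<Rightarrow> 'a \<Rightarrow> (nat \<Rightarrow> nat) \<Rightarrow> (nat \<Rightarrow> nat) \<Rightarrow> nat \<Rightarrow> 'a" where
  "row_weight a b c l v i =
     (if v i = l i then 1
      else (if 0 < v i \<and> v i = l (Suc i) \<and> v (Suc i) < v i then b else c) * a ^ (l i - v i - 1))"

definition removable :: "bool \<Rightarrow> (nat \<Rightarrow> nat \<Rightarrow> nat \<Rightarrow> bool) \<Rightarrow> nat \<Rightarrow> (nat \<Rightarrow> nat) \<Rightarrow> (nat \<Rightarrow> nat) set" where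
  "removable b Q t l = {v \<in> interlacing l. (b \<longrightarrow> strict_shape v) \<and>
     (\<forall>i d. v i \<le> d \<and> d < l i \<longrightarrow> Q i d t)}"

section \<open>Finiteness of the sets summed over\<close>

lemma finite_interlacing:
  assumes "\<And>i. n \<le> i \<Longrightarrow> l i = 0"
  shows "finite (interlacing l)"
proof (rule finite_subset)
  let ?B = "{..\<Sum>i<n. l i}"
  show "interlacing l \<subseteq> {f. \<forall>i. (i \<in> {..<n} \<longrightarrow> f i \<in> ?B) \<and> (i \<notin> {..<n} \<longrightarrow> f i = 0)}"
  proof (intro subsetI CollectI allI conjI impI)
    fix v i assume v: "v \<in> interlacing l"
    { assume "i \<in> {..<n}"
      then have "l i \<le> (\<Sum>i<n. l i)" by (intro member_le_sum) auto
      then show "v i \<in> ?B" using v by (auto simp: interlacing_def intro: order_trans)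
    }
    { assume "i \<notin> {..<n}"
      then show "v i = 0" using v assms[of i] by (auto simp: interlacing_def) (metis le_zero_eq)
    }
  qed
  show "finite {f. \<forall>i. (i \<in> {..<n} \<longrightarrow> f i \<in> ?B) \<and> (i \<notin> {..<n} \<longrightarrow> f i = 0)}"
    by (rule finite_set_of_finite_funs) auto
qed

lemma finite_fillings:
  assumes "\<And>i. n \<le> i \<Longrightarrow> l i = 0"
  shows "finite (fillings b Q m l)"
proof (rule finite_subset)
  let ?A = "Sigma {..<n} (\<lambda>i. {..<l i})"
  let ?F = "{f. \<forall>z. (z \<in> ?A \<longrightarrow> f z \<in> {..m}) \<and> (z \<notin> ?A \<longrightarrow> f z = 0)}"
  show "finite (curry ` ?F)"
    by (intro finite_imageI finite_set_of_finite_funs) auto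
  show "fillings b Q m l \<subseteq> curry ` ?F"
  proof
    fix T assume T: "T \<in> fillings b Q m l"
    have "case_prod T \<in> ?F"
    proof (intro CollectI allI conjI impI)
      fix z :: "nat \<times> nat"
      obtain i d where z: "z = (i, d)" by force
      { assume "z \<in> ?A" then show "case_prod T z \<in> {..m}"
          using T z by (auto simp: fillings_def) }
      { assume "z \<notin> ?A"
        then have "\<not> d < l i" using assms[of i] z by (cases "i < n") auto
        then show "case_prod T z = 0"
          using T z by (auto simp: fillings_def) }
    qed
    moreover have "T = curry (case_prod T)" by simp
    ultimately show "T \<in> curry ` ?F" by blast
  qed
qed

text \<open>The position \<open>l i\<close> satisfies the implication vacuously, so the minimum
  exists and is at most \<open>l i\<close> even if no entry of the row exceeds
  \<open>m\<close>.\<close>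

definition shape_upto :: "nat \<Rightarrow> (nat \<Rightarrow> nat) \<Rightarrow> (nat \<Rightarrow> nat \<Rightarrow> nat) \<Rightarrow> nat \<Rightarrow> nat" where
  "shape_upto m l T i = (LEAST d. d < l i \<longrightarrow> m < T i d)"

definition extend_filling :: "nat \<Rightarrow> (nat \<Rightarrow> nat) \<Rightarrow> (nat \<Rightarrow> nat) \<Rightarrow> (nat \<Rightarrow> nat \<Rightarrow> nat) \<Rightarrow> nat \<Rightarrow> nat \<Rightarrow> nat" where
  "extend_filling t l v T i d = (if d < v i then T i d else if d < l i then t else 0)"

definition restrict_filling :: "(nat \<Rightarrow> nat) \<Rightarrow> (nat \<Rightarrow> nat \<Rightarrow> nat) \<Rightarrow> nat \<Rightarrow> nat \<Rightarrow> nat" where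
  "restrict_filling v T i d = (if d < v i then T i d else 0)"

lemma fillings_row_mono:
  assumes "T \<in> fillings b Q m l" "d \<le> d'" "d' < l i"
  shows "T i d \<le> T i d'"
  using assms(2,3)
proof (induction d' rule: dec_induct)
  case base
  then show ?case by simp
next
  case (step k)
  have "T i k \<le> T i (Suc k)"
    using assms(1) step.prems by (simp add: fillings_def)
  then show ?case using step by simp
qed

lemma shape_upto_le: "shape_upto m l T i \<le> l i"
  unfolding shape_upto_def by (rule Least_le) simp

text \<open>Rows increase weakly, so the entries that are at most \<open>m\<close> form an initial
  segment of the row.\<close>

lemma less_shape_upto_iff:
  assumes "T \<in> fillings b Q m' l" "d < l i"
  shows "d < shape_upto m l T i \<longleftrightarrow> T i d \<le> m"
proof
  assume "d < shape_upto m l T i"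
  then show "T i d \<le> m" using not_less_Least assms(2) unfolding shape_upto_def by force
next
  assume *: "T i d \<le> m"
  show "d < shape_upto m l T i"
  proof (rule ccontr)
    assume "\<not> ?thesis"
    then have le: "shape_upto m l T i \<le> d" by simp
    have "shape_upto m l T i < l i \<longrightarrow> m < T i (shape_upto m l T i)"
      unfolding shape_upto_def by (rule LeastI[of _ "l i"]) simp
    moreover have "T i (shape_upto m l T i) \<le> T i d"
      using fillings_row_mono[OF assms(1) le assms(2)] .
    ultimately show False using le assms(2) * by simp
  qed
qed

text \<open>Comparisons of an old cell with a new one hold because old entries are at most
  \<open>m\<close>. Two new cells never share a position \<open>d\<close> in consecutive rows, by
  interlacing.\<close>

lemma extend_filling_mem:
  assumes v: "v \<in> removable b Q (Suc m) l" and T: "T \<in> fillings b Q m v"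
  shows "extend_filling (Suc m) l v T \<in> fillings b Q (Suc m) l"
proof -
  have vl: "v i \<le> l i" and lv: "l (Suc i) \<le> v i" for i
    using v by (auto simp: removable_def interlacing_def)
  have Q: "Q i d (Suc m)" if "v i \<le> d" "d < l i" for i d
    using v that by (auto simp: removable_def)
  have T1: "T i d \<le> m \<and> Q i d (T i d)" if "d < v i" for i d
    using T that by (auto simp: fillings_def)
  have T2: "T i d \<le> T i (Suc d)" if "Suc d < v i" for i d
    using T that by (auto simp: fillings_def)
  have T3: "T i d < T (Suc i) d" if "d < v (Suc i)" for i d
    using T that by (auto simp: fillings_def)
  have T4: "T i (Suc d) \<le> T (Suc i) d" if "b" "Suc d < v i" "d < v (Suc i)" for i d
    using T that by (auto simp: fillings_def)
  have sv: "v (Suc i) < v i" if b "0 < v i" for i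
    using v that by (auto simp: removable_def strict_shape_def)
  show ?thesis
    unfolding fillings_def mem_Collect_eq
  proof (intro conjI allI impI, goal_cases)
    case (1 i d) then show ?case using T1[of d i] by (auto simp: extend_filling_def)
  next
    case (2 i d) then show ?case using T1[of d i] Q[of i d] by (auto simp: extend_filling_def)
  next
    case (3 i d) then show ?case using vl[of i] by (auto simp: extend_filling_def)
  next
    case (4 i d) then show ?case using T2[of d i] T1[of d i] by (auto simp: extend_filling_def)
  next
    case (5 i d)
    then have "d < v i" using lv[of i] by simp
    then show ?case using 5 T3[of d i] T1[of d i] by (auto simp: extend_filling_def)
  next
    case (6 i d)
    show ?case
    proof (cases "d < v (Suc i)")
      case True
      \<comment> \<open>Strictness of \<open>v\<close> excludes a new cell at
        \<open>(i, Suc d)\<close> above an old one at \<open>(Suc i, d)\<close>.\<close>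
      then have "0 < v i" using vl[of "Suc i"] lv[of i] by simp
      then have "Suc d < v i" using sv[of i] True 6 by simp
      then show ?thesis using True T4[of d i] 6 by (auto simp: extend_filling_def)
    next
      case False
      then show ?thesis using 6 T1[of "Suc d" i] by (auto simp: extend_filling_def)
    qed
  qed
qed

text \<open>If \<open>v i < l (Suc i)\<close>, position \<open>v i\<close> would hold more than
  \<open>m\<close> in row \<open>i\<close> and hence more than \<open>Suc m\<close> in the next row.
  If \<open>v\<close> failed to be strict, an entry at most \<open>m\<close> would lie below one
  larger than \<open>m\<close>; strictness of \<open>l\<close> ensures that the upper cell of this
  pair exists.\<close>

lemma shape_upto_removable:
  assumes l: "\<And>i. l (Suc i) \<le> l i" and sl: "b \<Longrightarrow> strict_shape l" and T: "T \<in> fillings b Q (Suc m) l"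
  shows "shape_upto m l T \<in> removable b Q (Suc m) l"
proof -
  let ?v = "shape_upto m l T"
  note iff = less_shape_upto_iff[OF T]
  have T1: "T i d \<le> Suc m \<and> Q i d (T i d)" if "d < l i" for i d
    using T that by (auto simp: fillings_def)
  have T3: "T i d < T (Suc i) d" if "d < l (Suc i)" for i d
    using T that by (auto simp: fillings_def)
  have T4: "T i (Suc d) \<le> T (Suc i) d" if "b" "Suc d < l i" "d < l (Suc i)" for i d
    using T that by (auto simp: fillings_def)
  have lv: "l (Suc i) \<le> ?v i" for i
  proof (rule ccontr)
    assume "\<not> ?thesis"
    then have *: "?v i < l (Suc i)" by simp
    then have "T i (?v i) < T (Suc i) (?v i)" by (rule T3)
    also have "\<dots> \<le> Suc m" using T1[OF *] by simp
    finally have "T i (?v i) \<le> m" by simp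
    moreover have "?v i < l i" using * l[of i] by simp
    ultimately show False using iff[of "?v i" i m] by simp
  qed
  have "strict_shape ?v" if b
    unfolding strict_shape_def
  proof (intro allI impI, rule ccontr)
    fix i assume pos: "0 < ?v i" and "\<not> ?v (Suc i) < ?v i"
    then have le: "?v i \<le> ?v (Suc i)" by simp
    obtain d where d: "?v i = Suc d" using pos by (cases "?v i") auto
    have dl: "d < l (Suc i)" using le d shape_upto_le[of m l T "Suc i"] by simp
    have "l (Suc i) < l i" using sl[OF that] dl l[of i] by (auto simp: strict_shape_def)
    then have "Suc d < l i" using dl by simp
    then have "T i (Suc d) \<le> T (Suc i) d" using T4 that dl by simp
    moreover have "T (Suc i) d \<le> m" using iff[of d "Suc i" m] dl le d by simp
    moreover have "\<not> T i (Suc d) \<le> m" using iff[of "Suc d" i m] \<open>Suc d < l i\<close> d by simp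
    ultimately show False by simp
  qed
  moreover have "Q i d (Suc m)" if "?v i \<le> d" "d < l i" for i d
  proof -
    have "\<not> T i d \<le> m" using iff[of d i m] that by simp
    then have "T i d = Suc m" using T1[OF that(2)] by simp
    then show ?thesis using T1[OF that(2)] by simp
  qed
  ultimately show ?thesis
    using lv shape_upto_le by (auto simp: removable_def interlacing_def)
qed

lemma restrict_filling_mem:
  assumes l: "\<And>i. l (Suc i) \<le> l i" and T: "T \<in> fillings b Q (Suc m) l"
  shows "restrict_filling (shape_upto m l T) T \<in> fillings b Q m (shape_upto m l T)"
proof -
  let ?v = "shape_upto m l T"
  have vl: "d < l i" if "d < ?v i" for i d using shape_upto_le[of m l T i] that by simp
  have "T i d \<le> m \<and> Q i d (T i d)" if "d < ?v i" for i d
    using T that vl[OF that] less_shape_upto_iff[OF T vl[OF that], of m] by (auto simp: fillings_def)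
  moreover have "d < ?v i" if "d < ?v (Suc i)" for i d
  proof -
    have lt: "T i d < T (Suc i) d" using T vl[OF that] by (auto simp: fillings_def)
    have "d < l i" using vl[OF that] l[of i] by simp
    then show ?thesis
      using lt less_shape_upto_iff[OF T, of d i m] that less_shape_upto_iff[OF T vl[OF that], of m] by simp
  qed
  ultimately show ?thesis
    using T vl by (auto simp: fillings_def restrict_filling_def)
qed

text \<open>The weight of a cell depends only on which neighbours hold the same letter. Old and new
  cells hold different letters, so old weights are unchanged and the new cells contribute a factor
  determined by the two shapes.\<close>

lemma prod_cell_weight_extend_filling:
  assumes v: "v \<in> removable b Q (Suc m) l" and T: "T \<in> fillings b Q m v"
  shows "(\<Prod>d<l i. cell_weight \<alpha> \<beta> \<gamma> l (extend_filling (Suc m) l v T) i d) =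
    row_weight (\<alpha> (Suc m)) (\<beta> (Suc m)) (\<gamma> (Suc m)) l v i * (\<Prod>d<v i. cell_weight \<alpha> \<beta> \<gamma> v T i d)"
proof -
  let ?T = "extend_filling (Suc m) l v T" and ?t = "Suc m"
  have vl: "v i \<le> l i" and lv: "l (Suc i) \<le> v i" for i
    using v by (auto simp: removable_def interlacing_def)
  have Tm: "T i d \<le> m" if "d < v i" for i d using T that by (auto simp: fillings_def)
  have old: "cell_weight \<alpha> \<beta> \<gamma> l ?T i d = cell_weight \<alpha> \<beta> \<gamma> v T i d" if d: "d < v i" for d
  proof -
    have e: "?T i d = T i d" "?T i (d - 1) = T i (d - 1)"
      using d by (auto simp: extend_filling_def)
    have "(d - 1 < l (Suc i) \<and> ?T (Suc i) (d - 1) = T i d) \<longleftrightarrow>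
        (d - 1 < v (Suc i) \<and> T (Suc i) (d - 1) = T i d)"
      using Tm[OF d] vl[of "Suc i"] by (auto simp: extend_filling_def)
    then show ?thesis unfolding cell_weight_def e by simp
  qed
  have new: "cell_weight \<alpha> \<beta> \<gamma> l ?T i d = \<alpha> ?t" if d: "d \<in> {Suc (v i)..<l i}" for d
    using d by (auto simp: cell_weight_def extend_filling_def)
  have first: "cell_weight \<alpha> \<beta> \<gamma> l ?T i (v i) =
      (if 0 < v i \<and> v i = l (Suc i) \<and> v (Suc i) < v i then \<beta> ?t else \<gamma> ?t)" if "v i < l i"
  proof -
    have e: "?T i (v i) = ?t" using that by (simp add: extend_filling_def)
    have p: "?T i (v i - 1) \<noteq> ?t" if "0 < v i"
      using Tm[of "v i - 1" i] that by (auto simp: extend_filling_def)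
    have q: "(v i - 1 < l (Suc i) \<and> ?T (Suc i) (v i - 1) = ?t) \<longleftrightarrow>
       (v i = l (Suc i) \<and> v (Suc i) < v i)" if "0 < v i"
      using Tm[of "v i - 1" "Suc i"] that lv[of i] by (auto simp: extend_filling_def)
    show ?thesis
    proof (cases "0 < v i")
      case True
      then show ?thesis using p q unfolding cell_weight_def e by simp
    next
      case False
      then show ?thesis using e by (simp add: cell_weight_def)
    qed
  qed
  have "(\<Prod>d<l i. cell_weight \<alpha> \<beta> \<gamma> l ?T i d) =
     (\<Prod>d<v i. cell_weight \<alpha> \<beta> \<gamma> l ?T i d) * (\<Prod>d=v i..<l i. cell_weight \<alpha> \<beta> \<gamma> l ?T i d)"
    unfolding lessThan_atLeast0 by (rule prod.atLeastLessThan_concat[symmetric]) (use vl in auto)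
  also have "(\<Prod>d=v i..<l i. cell_weight \<alpha> \<beta> \<gamma> l ?T i d) =
     row_weight (\<alpha> ?t) (\<beta> ?t) (\<gamma> ?t) l v i"
  proof (cases "v i = l i")
    case True
    then show ?thesis by (simp add: row_weight_def)
  next
    case False
    then have "v i < l i" using vl[of i] by simp
    then have "(\<Prod>d=v i..<l i. cell_weight \<alpha> \<beta> \<gamma> l ?T i d) =
       cell_weight \<alpha> \<beta> \<gamma> l ?T i (v i) * (\<Prod>d=Suc (v i)..<l i. cell_weight \<alpha> \<beta> \<gamma> l ?T i d)"
      by (rule prod.atLeast_Suc_lessThan)
    also have "(\<Prod>d=Suc (v i)..<l i. cell_weight \<alpha> \<beta> \<gamma> l ?T i d) = \<alpha> ?t ^ (l i - v i - 1)"
      using new by simp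
    finally show ?thesis using first \<open>v i < l i\<close> by (simp add: row_weight_def)
  qed
  also have "(\<Prod>d<v i. cell_weight \<alpha> \<beta> \<gamma> l ?T i d) = (\<Prod>d<v i. cell_weight \<alpha> \<beta> \<gamma> v T i d)"
    using old by simp
  finally show ?thesis by (simp only: mult.commute)
qed

text \<open>Branching rule: a filling corresponds to the shape \<open>v\<close> of its entries up to
  \<open>m\<close> together with its restriction to \<open>v\<close>, and the weight factors
  accordingly.\<close>

lemma filling_sum_Suc:
  assumes l: "\<And>i. l (Suc i) \<le> l i" and n: "\<And>i. n \<le> i \<Longrightarrow> l i = 0" and sl: "b \<Longrightarrow> strict_shape l"
  shows "filling_sum \<alpha> \<beta> \<gamma> b Q n (Suc m) l =
    (\<Sum>v\<in>removable b Q (Suc m) l.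
      (\<Prod>i<n. row_weight (\<alpha> (Suc m)) (\<beta> (Suc m)) (\<gamma> (Suc m)) l v i) * filling_sum \<alpha> \<beta> \<gamma> b Q n m v)"
proof -
  let ?R = "removable b Q (Suc m) l"
  let ?rw = "\<lambda>v i. row_weight (\<alpha> (Suc m)) (\<beta> (Suc m)) (\<gamma> (Suc m)) l v i"
  let ?W = "\<lambda>l T. \<Prod>i<n. \<Prod>d<l i. cell_weight \<alpha> \<beta> \<gamma> l T i d"
  have fin: "finite ?R"
    using finite_interlacing[OF n] by (auto simp: removable_def)
  have finf: "finite (fillings b Q m v)" if "v \<in> ?R" for v
  proof (rule finite_fillings)
    fix i assume "n \<le> i"
    moreover have "v i \<le> l i" using that by (auto simp: removable_def interlacing_def)
    ultimately show "v i = 0" using n[of i] by simp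
  qed
  have "filling_sum \<alpha> \<beta> \<gamma> b Q n (Suc m) l =
     (\<Sum>z\<in>Sigma ?R (fillings b Q m). (\<Prod>i<n. ?rw (fst z) i) * ?W (fst z) (snd z))"
    unfolding filling_sum_def
  proof (rule sum.reindex_bij_witness[where i = "\<lambda>(v, T). extend_filling (Suc m) l v T"
        and j = "\<lambda>T. (shape_upto m l T, restrict_filling (shape_upto m l T) T)"])
    fix T assume T: "T \<in> fillings b Q (Suc m) l"
    let ?v = "shape_upto m l T"
    have "extend_filling (Suc m) l ?v (restrict_filling ?v T) i d = T i d" for i d
    proof (cases "d < l i")
      case True
      then have "T i d \<le> Suc m" using T by (auto simp: fillings_def)
      then show ?thesis using True less_shape_upto_iff[OF T True, of m]
        by (auto simp: extend_filling_def restrict_filling_def)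
    next
      case False
      then have "T i d = 0" using T by (auto simp: fillings_def)
      then show ?thesis using False by (auto simp: extend_filling_def restrict_filling_def)
    qed
    then show ext: "(case (?v, restrict_filling ?v T) of (v, T) \<Rightarrow> extend_filling (Suc m) l v T) = T"
      by (auto simp: fun_eq_iff)
    show mem: "(?v, restrict_filling ?v T) \<in> Sigma ?R (fillings b Q m)"
      using shape_upto_removable[OF l sl T] restrict_filling_mem[OF l T] by auto
    show "(\<Prod>i<n. ?rw (fst (?v, restrict_filling ?v T)) i) *
        ?W (fst (?v, restrict_filling ?v T)) (snd (?v, restrict_filling ?v T)) = ?W l T"
      using prod_cell_weight_extend_filling[where v = ?v and T = "restrict_filling ?v T" and l = l and m = m and b = b
        and Q = Q and \<alpha> = \<alpha> and \<beta> = \<beta> and \<gamma> = \<gamma>] mem ext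
      by (simp add: prod.distrib)
  next
    fix z assume z: "z \<in> Sigma ?R (fillings b Q m)"
    obtain v T where zz: "z = (v, T)" by force
    have v: "v \<in> ?R" and T: "T \<in> fillings b Q m v" using z zz by auto
    have E: "extend_filling (Suc m) l v T \<in> fillings b Q (Suc m) l"
      by (rule extend_filling_mem[OF v T])
    then show "(case z of (v, T) \<Rightarrow> extend_filling (Suc m) l v T) \<in> fillings b Q (Suc m) l"
      using zz by simp
    have vl: "v i \<le> l i" for i using v by (auto simp: removable_def interlacing_def)
    have "shape_upto m l (extend_filling (Suc m) l v T) i = v i" for i
      unfolding shape_upto_def
    proof (rule Least_equality)
      show "v i < l i \<longrightarrow> m < extend_filling (Suc m) l v T i (v i)"
        by (auto simp: extend_filling_def)
      fix d assume d: "d < l i \<longrightarrow> m < extend_filling (Suc m) l v T i d"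
      have "T i d \<le> m" if "d < v i" using T that by (auto simp: fillings_def)
      then show "v i \<le> d" using d vl[of i] by (auto simp: extend_filling_def split: if_splits)
    qed
    then have S: "shape_upto m l (extend_filling (Suc m) l v T) = v" by auto
    have "T i d = 0" if "\<not> d < v i" for i d using T that by (auto simp: fillings_def)
    then have "restrict_filling v (extend_filling (Suc m) l v T) = T"
      by (auto simp: fun_eq_iff restrict_filling_def extend_filling_def)
    then show "(shape_upto m l (case z of (v, T) \<Rightarrow> extend_filling (Suc m) l v T),
         restrict_filling (shape_upto m l (case z of (v, T) \<Rightarrow> extend_filling (Suc m) l v T))
          (case z of (v, T) \<Rightarrow> extend_filling (Suc m) l v T)) = z"
      using S zz by simp
  qed
  also have "\<dots> = (\<Sum>v\<in>?R. \<Sum>T\<in>fillings b Q m v. (\<Prod>i<n. ?rw v i) * ?W v T)"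
    using sum.Sigma[OF fin, of "fillings b Q m" "\<lambda>v T. (\<Prod>i<n. ?rw v i) * ?W v T"] finf
    by (simp add: split_def)
  finally show ?thesis by (simp add: filling_sum_def sum_distrib_left)
qed

section \<open>Strips and determinants\<close>

no_notation vec_index (infixl \<open>$\<close> 100)
notation fps_nth (infixl \<open>$\<close> 75)

text \<open>Multilinearity in the rows, obtained by distributing each product of the Leibniz formula
  over the sums. The choice functions vanish from \<open>k\<close> on so that they can be read as
  shapes.\<close>

lemma det_mat_rows_sum:
  fixes f :: "nat \<Rightarrow> nat \<Rightarrow> nat \<Rightarrow> 'a::comm_ring_1"
  assumes "\<And>i. i < k \<Longrightarrow> finite (R i)"
  shows "det (mat k k (\<lambda>(i, j). \<Sum>r\<in>R i. u i r * f i j r)) =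
    (\<Sum>v | (\<forall>i<k. v i \<in> R i) \<and> (\<forall>i\<ge>k. v i = 0).
      (\<Prod>i<k. u i (v i)) * det (mat k k (\<lambda>(i, j). f i j (v i))))"
proof -
  let ?P = "{p. p permutes {0..<k}}"
  let ?E = "PiE {..<k} R"
  let ?V = "{v. (\<forall>i<k. v i \<in> R i) \<and> (\<forall>i\<ge>k. v i = 0)}"
  have lt: "p i < k" if "p \<in> ?P" "i < k" for p i
    using that permutes_in_image[of p "{0..<k}" i] by auto
  have "det (mat k k (\<lambda>(i, j). \<Sum>r\<in>R i. u i r * f i j r)) =
      (\<Sum>p\<in>?P. signof p * (\<Prod>i<k. \<Sum>r\<in>R i. u i r * f i (p i) r))"
    unfolding det_def using lt by (auto simp: lessThan_atLeast0 intro!: sum.cong prod.cong arg_cong2[where f = "(*)"])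
  also have "\<dots> = (\<Sum>p\<in>?P. signof p * (\<Sum>v\<in>?E. \<Prod>i<k. u i (v i) * f i (p i) (v i)))"
    using assms by (subst prod_sum_PiE) auto
  also have "\<dots> = (\<Sum>v\<in>?E. (\<Prod>i<k. u i (v i)) * (\<Sum>p\<in>?P. signof p * (\<Prod>i<k. f i (p i) (v i))))"
    unfolding sum_distrib_left prod.distrib by (subst sum.swap) (simp only: mult_ac)
  also have "\<dots> = (\<Sum>v\<in>?E. (\<Prod>i<k. u i (v i)) * det (mat k k (\<lambda>(i, j). f i j (v i))))"
    unfolding det_def using lt
    by (auto simp: lessThan_atLeast0 intro!: sum.cong prod.cong arg_cong2[where f = "(*)"])
  also have "\<dots> = (\<Sum>v\<in>?V. (\<Prod>i<k. u i (v i)) * det (mat k k (\<lambda>(i, j). f i j (v i))))"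
    by (rule sum.reindex_bij_witness[where i = "\<lambda>v. restrict v {..<k}" and j = "\<lambda>v i. if i < k then v i else 0"])
      (auto simp: PiE_def extensional_def fun_eq_iff intro!: prod.cong arg_cong2[where f = "(*)"]
          arg_cong[where f = det] eq_matI)
  finally show ?thesis .
qed

text \<open>Left multiplication by an upper bidiagonal matrix with unit diagonal.\<close>

lemma det_mat_add_next_row:
  fixes A :: "nat \<Rightarrow> nat \<Rightarrow> 'a::comm_ring_1"
  shows "det (mat k k (\<lambda>(i, j). if Suc i < k then A i j + c i * A (Suc i) j else A i j)) =
    det (mat k k (\<lambda>(i, j). A i j))"
proof -
  let ?L = "mat k k (\<lambda>(i, j). if j = i then 1 else if j = Suc i then c i else 0)"
  let ?A = "mat k k (\<lambda>(i, j). A i j)"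
  have "mat k k (\<lambda>(i, j). if Suc i < k then A i j + c i * A (Suc i) j else A i j) = ?L * ?A"
  proof (rule eq_matI)
    fix i j assume "i < dim_row (?L * ?A)" "j < dim_col (?L * ?A)"
    then have ij: "i < k" "j < k" by auto
    have "(?L * ?A) $$ (i, j) =
        (\<Sum>r<k. (if r = i then A r j else 0) + (if r = Suc i then c i * A r j else 0))"
      using ij by (auto simp: scalar_prod_def lessThan_atLeast0 intro!: sum.cong)
    also have "\<dots> = (if Suc i < k then A i j + c i * A (Suc i) j else A i j)"
      using ij by (simp add: sum.distrib)
    finally show "mat k k (\<lambda>(i, j). if Suc i < k then A i j + c i * A (Suc i) j else A i j) $$ (i, j) =
        (?L * ?A) $$ (i, j)" using ij by simp
  qed auto
  moreover have "det ?L = 1"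
    by (subst det_upper_triangular[of _ k])
      (auto simp: upper_triangular_def prod_list_diag_prod intro!: prod.neutral)
  ultimately show ?thesis by (simp add: det_mult[of _ k])
qed

text \<open>Right multiplication by a lower bidiagonal matrix with diagonal \<open>c\<close>. The
  last column has no right neighbour inside the matrix; the assumption makes the term
  \<open>A i k\<close> vanish there.\<close>

lemma det_mat_add_next_column:
  fixes A :: "nat \<Rightarrow> nat \<Rightarrow> 'a::comm_ring_1"
  assumes "\<And>i. i < k \<Longrightarrow> A i k = 0"
  shows "det (mat k k (\<lambda>(i, j). A i (Suc j) + c j * A i j)) =
    (\<Prod>j<k. c j) * det (mat k k (\<lambda>(i, j). A i j))"
proof -
  let ?L = "mat k k (\<lambda>(i, j). if i = j then c j else if i = Suc j then 1 else 0)"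
  let ?A = "mat k k (\<lambda>(i, j). A i j)"
  have "mat k k (\<lambda>(i, j). A i (Suc j) + c j * A i j) = ?A * ?L"
  proof (rule eq_matI)
    fix i j assume "i < dim_row (?A * ?L)" "j < dim_col (?A * ?L)"
    then have ij: "i < k" "j < k" by auto
    have "(?A * ?L) $$ (i, j) =
        (\<Sum>r<k. (if r = j then c j * A i r else 0) + (if r = Suc j then A i r else 0))"
      using ij by (auto simp: scalar_prod_def lessThan_atLeast0 intro!: sum.cong)
    also have "\<dots> = A i (Suc j) + c j * A i j"
    proof (cases "Suc j < k")
      case False
      then have "Suc j = k" using ij by simp
      then show ?thesis using ij assms[of i] by (simp add: sum.distrib)
    qed (use ij in \<open>simp add: sum.distrib\<close>)
    finally show "mat k k (\<lambda>(i, j). A i (Suc j) + c j * A i j) $$ (i, j) = (?A * ?L) $$ (i, j)"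
      using ij by simp
  qed auto
  moreover have "det ?L = (\<Prod>j<k. c j)"
    by (subst det_lower_triangular[of k])
      (auto simp: prod_list_diag_prod lessThan_atLeast0 intro!: prod.cong)
  ultimately show ?thesis by (simp add: det_mult[of _ k] mult.commute)
qed

lemma det_mat_equal_rows:
  fixes A :: "nat \<Rightarrow> nat \<Rightarrow> 'a::comm_ring_1"
  assumes "i < k" "i' < k" "i \<noteq> i'" "\<And>j. j < k \<Longrightarrow> A i j = A i' j"
  shows "det (mat k k (\<lambda>(i, j). A i j)) = 0"
  by (rule det_identical_rows[of _ k i i']) (use assms in \<open>auto intro!: eq_vecI\<close>)

lemma det_mat_zero_row:
  fixes A :: "nat \<Rightarrow> nat \<Rightarrow> 'a::comm_ring_1"
  assumes "i < k" "\<And>j. j < k \<Longrightarrow> A i j = 0"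
  shows "det (mat k k (\<lambda>(i, j). A i j)) = 0"
proof -
  have lt: "p i < k" if "p permutes {0..<k}" for p
    using assms(1) that permutes_in_image[of p "{0..<k}" i] by auto
  have "(\<Prod>r = 0..<k. mat k k (\<lambda>(i, j). A i j) $$ (r, p r)) = 0" if "p permutes {0..<k}" for p
    by (rule prod_zero) (use assms lt[OF that] in \<open>auto intro!: bexI[of _ i]\<close>)
  then show ?thesis by (simp add: det_def)
qed

lemma det_mat_last_column:
  fixes A :: "nat \<Rightarrow> nat \<Rightarrow> 'a::comm_ring_1"
  assumes "\<And>i. i < k \<Longrightarrow> A i k = 0"
  shows "det (mat (Suc k) (Suc k) (\<lambda>(i, j). A i j)) = A k k * det (mat k k (\<lambda>(i, j). A i j))"
proof -
  let ?M = "mat (Suc k) (Suc k) (\<lambda>(i, j). A i j)"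
  have "det ?M = (\<Sum>i<Suc k. ?M $$ (i, k) * cofactor ?M i k)"
    by (rule laplace_expansion_column) auto
  also have "\<dots> = A k k * cofactor ?M k k"
    using assms by simp
  also have "cofactor ?M k k = det (mat k k (\<lambda>(i, j). A i j))"
    unfolding cofactor_def mat_delete_def
    by (auto simp: intro!: arg_cong[where f = det] eq_matI)
  finally show ?thesis .
qed

text \<open>Multiplication by \<open>(1 + b X) / (1 - a X)\<close> sends a column \<open>F\<close> to the column of weighted
  one-row strips: a strip of length \<open>m > 0\<close> has weight \<open>(a + b) a\<^sup>m\<^sup>-\<^sup>1\<close>.\<close>

definition strip_series :: "'a::field \<Rightarrow> 'a \<Rightarrow> 'a fps" where
  "strip_series a b = (1 + fps_const b * fps_X) * inverse (1 - fps_const a * fps_X)"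

lemma strip_series_mult:
  "strip_series a b * (1 - fps_const a * fps_X) = 1 + fps_const b * fps_X"
  by (simp add: strip_series_def mult.assoc inverse_mult_eq_1)

lemma strip_series_nth_0: "strip_series a b $ 0 = 1"
  by (simp add: strip_series_def)

lemma strip_series_mult_nth_Suc:
  "(strip_series a b * F) $ Suc p = a * (strip_series a b * F) $ p + F $ Suc p + b * F $ p"
proof -
  define G where "G = strip_series a b * F"
  have "G * (1 - fps_const a * fps_X) = (1 + fps_const b * fps_X) * F"
    using strip_series_mult[of a b] unfolding G_def by (metis mult.assoc mult.commute)
  then have "G - fps_const a * (fps_X * G) = F + fps_const b * (fps_X * F)"
    by (simp add: algebra_simps)
  then have "(G - fps_const a * (fps_X * G)) $ Suc p = (F + fps_const b * (fps_X * F)) $ Suc p"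
    by (rule arg_cong)
  then show ?thesis unfolding G_def[symmetric] by (simp add: diff_eq_eq add_ac)
qed

text \<open>Subtracting a multiple of the next row truncates the sum at the next part \<open>q\<close> and changes
  the weight of the strip that reaches \<open>q\<close> from \<open>a + b\<close> to \<open>b\<close>, exactly as the tableau weight does.\<close>

lemma strip_series_mult_nth_diff:
  assumes "q < p"
  shows "(strip_series a b * F) $ p - a ^ (p - q) * (strip_series a b * F) $ q =
    (\<Sum>r=q..p. (if r = p then 1 else (if r = q then b else a + b) * a ^ (p - r - 1)) * F $ r)"
  using assms
proof (induction p)
  case (Suc p)
  define G where "G = strip_series a b * F"
  note IH = Suc.IH[folded G_def]
  let ?w = "\<lambda>p r. (if r = p then 1 else (if r = q then b else a + b) * a ^ (p - r - 1))"
  have G: "G $ Suc p - a ^ (Suc p - q) * G $ q = a * (G $ p - a ^ (p - q) * G $ q) + F $ Suc p + b * F $ p"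
    using Suc.prems strip_series_mult_nth_Suc[of a b F p, folded G_def]
    by (simp add: Suc_diff_le algebra_simps)
  show ?case
  proof (cases "q = p")
    case True
    then show ?thesis using G unfolding G_def[symmetric] by (simp add: algebra_simps)
  next
    case False
    then have "q < p" using Suc.prems by simp
    \<comment> \<open>The two top terms are split off: below \<open>p\<close> the weights for
      \<open>Suc p\<close> are \<open>a\<close> times those for \<open>p\<close>, but at
      \<open>p\<close> the weight changes from 1 to \<open>a + b\<close>.\<close>
    have "(\<Sum>r=q..Suc p. ?w (Suc p) r * F $ r) = (\<Sum>r=q..<p. ?w (Suc p) r * F $ r) + (a + b) * F $ p + F $ Suc p"
      using \<open>q < p\<close> by (simp add: sum.last_plus atLeastLessThanSuc_atLeastAtMost[symmetric])
    also have "(\<Sum>r=q..<p. ?w (Suc p) r * F $ r) = a * (\<Sum>r=q..<p. ?w p r * F $ r)"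
      unfolding sum_distrib_left
    proof (rule sum.cong[OF refl])
      fix r assume r: "r \<in> {q..<p}"
      then have "Suc p - r - 1 = Suc (p - r - 1)" by auto
      then show "?w (Suc p) r * F $ r = a * (?w p r * F $ r)" using r by auto
    qed
    also have "(\<Sum>r=q..<p. ?w p r * F $ r) = (\<Sum>r=q..p. ?w p r * F $ r) - F $ p"
      using \<open>q < p\<close> by (simp add: atLeastLessThanSuc_atLeastAtMost[symmetric])
    finally show ?thesis using G IH[OF \<open>q < p\<close>] unfolding G_def[symmetric] by (simp add: algebra_simps)
  qed
qed simp

text \<open>The version for the last row, which has no row to subtract. It is the case
  \<open>q = 0\<close> above with \<open>a ^ p * F $ 0\<close> added back, which restores the weight
  \<open>a + b\<close> of the strip that reaches 0.\<close>

lemma strip_series_mult_nth: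
  "(strip_series a b * F) $ p =
    (\<Sum>r=0..p. (if r = p then 1 else (a + b) * a ^ (p - r - 1)) * F $ r)"
proof (cases "p = 0")
  case False
  have "(strip_series a b * F) $ p = (\<Sum>r=0..p. (if r = p then 1 else (if r = 0 then b else a + b) * a ^ (p - r - 1)) * F $ r)
     + a ^ p * F $ 0"
    using strip_series_mult_nth_diff[of 0 p a b F] False
    by (simp only: strip_series_nth_0 fps_mult_nth_0 diff_eq_eq) simp
  also have "a ^ p * F $ 0 = (\<Sum>r=0..p. if r = 0 then a * a ^ (p - 1) * F $ 0 else 0)"
    using False by (simp add: power_eq_if)
  finally show ?thesis using False
    by (simp only: sum.distrib[symmetric]) (auto intro!: sum.cong simp: algebra_simps)
qed (simp add: strip_series_nth_0)

text \<open>Subtracting \<open>a ^ (l i - l (Suc i))\<close> times row \<open>i + 1\<close> from row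
  \<open>i\<close> confines the sum in row \<open>i\<close> to \<open>l (Suc i)..l i\<close>. Row
  \<open>k\<close> already has this form, as \<open>l (Suc k) = 0\<close>. Multilinearity then
  yields one determinant for each interlacing \<open>v\<close>.\<close>

lemma det_strip_series_mult:
  fixes F :: "nat \<Rightarrow> 'a::field fps"
  assumes l: "\<And>i. i < k \<Longrightarrow> l (Suc i) < l i" and z: "\<And>i. k < i \<Longrightarrow> l i = 0"
  shows "det (mat (Suc k) (Suc k) (\<lambda>(i, j). (strip_series a b * F j) $ l i)) =
    (\<Sum>v\<in>interlacing l.
      (\<Prod>i\<le>k. if v i = l i then 1 else (if i < k \<and> v i = l (Suc i) then b else a + b) * a ^ (l i - v i - 1)) *
      det (mat (Suc k) (Suc k) (\<lambda>(i, j). F j $ v i)))"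
proof -
  let ?G = "\<lambda>j. strip_series a b * F j"
  let ?w = "\<lambda>i r. if r = l i then 1 else (if i < k \<and> r = l (Suc i) then b else a + b) * a ^ (l i - r - 1)"
  have "det (mat (Suc k) (Suc k) (\<lambda>(i, j). ?G j $ l i)) =
     det (mat (Suc k) (Suc k) (\<lambda>(i, j). if Suc i < Suc k
       then ?G j $ l i + (- (a ^ (l i - l (Suc i)))) * ?G j $ l (Suc i) else ?G j $ l i))"
    by (rule det_mat_add_next_row[symmetric])
  also have "mat (Suc k) (Suc k) (\<lambda>(i, j). if Suc i < Suc k
       then ?G j $ l i + (- (a ^ (l i - l (Suc i)))) * ?G j $ l (Suc i) else ?G j $ l i) =
     mat (Suc k) (Suc k) (\<lambda>(i, j). \<Sum>r=l (Suc i)..l i. ?w i r * F j $ r)"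
  proof (rule eq_matI, goal_cases)
    case (1 i j)
    then have ij: "i \<le> k" "j \<le> k" by auto
    show ?case
    proof (cases "i < k")
      case True
      then show ?thesis using ij strip_series_mult_nth_diff[OF l[OF True], of a b "F j"] by (simp cong: if_cong)
    next
      case False
      then have "i = k" "l (Suc i) = 0" using ij z[of "Suc i"] by auto
      then show ?thesis using ij strip_series_mult_nth[of a b "F j" "l i"] by (simp cong: if_cong)
    qed
  qed auto
  also have "det \<dots> = (\<Sum>v | (\<forall>i<Suc k. v i \<in> {l (Suc i)..l i}) \<and> (\<forall>i\<ge>Suc k. v i = 0).
      (\<Prod>i<Suc k. ?w i (v i)) * det (mat (Suc k) (Suc k) (\<lambda>(i, j). F j $ v i)))"
    by (rule det_mat_rows_sum) simp
  also have "{v. (\<forall>i<Suc k. v i \<in> {l (Suc i)..l i}) \<and> (\<forall>i\<ge>Suc k. v i = 0)} = interlacing l"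
    unfolding interlacing_def
  proof (intro Collect_cong iffI conjI allI impI)
    fix v i assume *: "(\<forall>i<Suc k. v i \<in> {l (Suc i)..l i}) \<and> (\<forall>i\<ge>Suc k. v i = 0)"
    show "l (Suc i) \<le> v i" "v i \<le> l i"
      using * z[of "Suc i"] by (cases "i < Suc k"; auto)+
  next
    fix v i assume *: "\<forall>i. l (Suc i) \<le> v i \<and> v i \<le> l i"
    { show "v i \<in> {l (Suc i)..l i}" using * by simp }
    { assume "Suc k \<le> i" then show "v i = 0" using * z[of i] by (metis Suc_le_lessD le_zero_eq) }
  qed
  finally show ?thesis by (simp only: lessThan_Suc_atMost)
qed

section \<open>Determinantal formulas\<close>

text \<open>Row \<open>i\<close> is row \<open>i + 1\<close> of the tableau, and
  \<open>2 * i + 2\<close> and \<open>2 * i + 3\<close> are the ranks of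
  \<open>Plain (i + 1)\<close> and \<open>Bar (i + 1)\<close>.\<close>

definition starts_on_diagonal :: "nat \<Rightarrow> nat \<Rightarrow> nat \<Rightarrow> bool" where
  "starts_on_diagonal i d t \<longleftrightarrow> (d = 0 \<longrightarrow> t = 2 * i + 2 \<or> t = 2 * i + 3)"

definition symplectic_bound :: "nat \<Rightarrow> nat \<Rightarrow> nat \<Rightarrow> bool" where
  "symplectic_bound i d t \<longleftrightarrow> 2 * i + 2 \<le> t"

section \<open>Boundary cases and the addition of one letter\<close>

lemma filling_sum_empty_shape:
  "filling_sum \<alpha> \<beta> \<gamma> b Q n m (\<lambda>_. 0) = 1"
proof -
  have "fillings b Q m (\<lambda>_. 0) = {\<lambda>_ _. 0}"
    by (auto simp: fillings_def fun_eq_iff)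
  then show ?thesis by (simp add: filling_sum_def)
qed

lemma filling_sum_eq_0:
  assumes "0 < l i" "\<And>t. Q i 0 t \<Longrightarrow> m < t"
  shows "filling_sum \<alpha> \<beta> \<gamma> b Q n m l = 0"
proof -
  have "fillings b Q m l = {}"
  proof (rule equals0I)
    fix T assume "T \<in> fillings b Q m l"
    then have "T i 0 \<le> m \<and> Q i 0 (T i 0)" using assms(1) by (simp add: fillings_def)
    then show False using assms(2)[of "T i 0"] by simp
  qed
  then show ?thesis by (simp add: filling_sum_def)
qed

text \<open>The branching rule runs over the interlacing \<open>v\<close> that are strict in rows 0
  to \<open>k\<close>, the determinant expansion over all interlacing \<open>v\<close>. The two sums
  agree because the additional determinants vanish.\<close>

lemma shifted_filling_sum_Suc:
  fixes F :: "nat \<Rightarrow> 'a::field fps"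
  assumes l: "\<And>i. i < k \<Longrightarrow> l (Suc i) < l i" and z: "\<And>i. k < i \<Longrightarrow> l i = 0" and kn: "k < n"
    and t: "Suc m = 2 * k + 2 \<or> Suc m = 2 * k + 3"
    and hyp: "\<And>v. v \<in> interlacing l \<Longrightarrow> (\<And>i. i < k \<Longrightarrow> v (Suc i) < v i) \<Longrightarrow>
      filling_sum a b (\<lambda>t. a t + b t) True starts_on_diagonal n m v =
        C * det (mat (Suc k) (Suc k) (\<lambda>(i, j). F j $ v i))"
  shows "filling_sum a b (\<lambda>t. a t + b t) True starts_on_diagonal n (Suc m) l =
    C * det (mat (Suc k) (Suc k) (\<lambda>(i, j). (strip_series (a (Suc m)) (b (Suc m)) * F j) $ l i))"
proof -
  let ?t = "Suc m"
  let ?det = "\<lambda>v. det (mat (Suc k) (Suc k) (\<lambda>(i, j). F j $ v i))"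
  let ?S = "{v \<in> interlacing l. \<forall>i<k. v (Suc i) < v i}"
  let ?w = "\<lambda>v i. if v i = l i then 1
    else (if i < k \<and> v i = l (Suc i) then b ?t else a ?t + b ?t) * a ?t ^ (l i - v i - 1)"
  have dec: "l (Suc i) \<le> l i" for i
    using l[of i] z[of "Suc i"] by (cases "i < k") auto
  have str: "strict_shape l"
    unfolding strict_shape_def
  proof (intro allI impI)
    fix i assume "0 < l i"
    then show "l (Suc i) < l i" using l[of i] z[of i] z[of "Suc i"] by (cases "i < k") auto
  qed
  have vz: "v i = 0" if "v \<in> interlacing l" "k < i" for v i
    using that z[of i] by (auto simp: interlacing_def) (metis le_zero_eq)
  have R: "removable True starts_on_diagonal ?t l = ?S"
  proof (intro equalityI subsetI)
    fix v assume v: "v \<in> removable True starts_on_diagonal ?t l"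
    then have vi: "v \<in> interlacing l" and vs: "strict_shape v"
      and Q: "\<And>i d. v i \<le> d \<Longrightarrow> d < l i \<Longrightarrow> starts_on_diagonal i d ?t"
      by (auto simp: removable_def)
    have "v (Suc i) < v i" if "i < k" for i
    proof (cases "0 < v i")
      case True
      then show ?thesis using vs by (simp add: strict_shape_def)
    next
      case False
      \<comment> \<open>Emptying row \<open>i < k\<close> would put a letter of index
        \<open>k + 1\<close> on the diagonal of a row that only admits index
        \<open>i + 1\<close>.\<close>
      then have "starts_on_diagonal i 0 ?t" using Q[of i 0] l[OF that] by simp
      then have False using t that unfolding starts_on_diagonal_def by presburger
      then show ?thesis ..
    qed
    then show "v \<in> ?S" using vi by simp
  next
    fix v assume "v \<in> ?S"
    then have vi: "v \<in> interlacing l" and vs: "\<And>i. i < k \<Longrightarrow> v (Suc i) < v i" by auto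
    have "v (Suc i) < v i" if "0 < v i" for i
      using vs[of i] vz[OF vi, of "Suc i"] that by (cases "i < k") auto
    moreover have "starts_on_diagonal i d ?t" if "v i \<le> d" "d < l i" for i d
    proof -
      have "i \<le> k" using z[of i] that by (metis not_less not_less_zero)
      moreover have "0 < d" if "i < k" using vs[OF that] \<open>v i \<le> d\<close> by simp
      ultimately show ?thesis using t by (cases "i < k") (auto simp: starts_on_diagonal_def)
    qed
    ultimately show "v \<in> removable True starts_on_diagonal ?t l"
      using vi by (auto simp: removable_def strict_shape_def)
  qed
  have w: "(\<Prod>i<n. row_weight (a ?t) (b ?t) (a ?t + b ?t) l v i) = (\<Prod>i\<le>k. ?w v i)" if "v \<in> ?S" for v
  proof -
    have vi: "v \<in> interlacing l" and vs: "\<And>i. i < k \<Longrightarrow> v (Suc i) < v i" using that by auto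
    have "(\<Prod>i<n. row_weight (a ?t) (b ?t) (a ?t + b ?t) l v i) = (\<Prod>i\<le>k. row_weight (a ?t) (b ?t) (a ?t + b ?t) l v i)"
      by (rule prod.mono_neutral_right) (use kn vz[OF vi] z in \<open>auto simp: row_weight_def\<close>)
    also have "\<dots> = (\<Prod>i\<le>k. ?w v i)"
    proof (rule prod.cong[OF refl])
      fix i assume "i \<in> {..k}"
      then show "row_weight (a ?t) (b ?t) (a ?t + b ?t) l v i = ?w v i"
        using vs[of i] z[of "Suc i"] by (cases "i < k") (auto simp: row_weight_def)
    qed
    finally show ?thesis .
  qed
  \<comment> \<open>Since \<open>v (Suc i) \<le> l (Suc i) \<le> v i\<close>, a failure of
    strictness makes rows \<open>i\<close> and \<open>i + 1\<close> equal.\<close>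
  have zero: "?det v = 0" if v: "v \<in> interlacing l - ?S" for v
  proof -
    obtain i where "i < k" "\<not> v (Suc i) < v i" using v by blast
    then have i: "i < k" "v i \<le> v (Suc i)" by simp_all
    have "v (Suc i) \<le> l (Suc i)" "l (Suc i) \<le> v i" using that by (auto simp: interlacing_def)
    then have "v i = v (Suc i)" using i by simp
    then show ?thesis using i by (intro det_mat_equal_rows[of i _ "Suc i"]) auto
  qed
  have "filling_sum a b (\<lambda>t. a t + b t) True starts_on_diagonal n (Suc m) l =
      (\<Sum>v\<in>?S. (\<Prod>i<n. row_weight (a ?t) (b ?t) (a ?t + b ?t) l v i) *
        filling_sum a b (\<lambda>t. a t + b t) True starts_on_diagonal n m v)"
    unfolding R[symmetric] by (rule filling_sum_Suc) (use dec z kn str in auto)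
  also have "\<dots> = (\<Sum>v\<in>?S. (\<Prod>i\<le>k. ?w v i) * (C * ?det v))"
  proof (rule sum.cong[OF refl])
    fix v assume v: "v \<in> ?S"
    show "(\<Prod>i<n. row_weight (a ?t) (b ?t) (a ?t + b ?t) l v i) *
        filling_sum a b (\<lambda>t. a t + b t) True starts_on_diagonal n m v =
      (\<Prod>i\<le>k. ?w v i) * (C * ?det v)"
      unfolding w[OF v] by (subst hyp) (use v in auto)
  qed
  also have "\<dots> = (\<Sum>v\<in>interlacing l. (\<Prod>i\<le>k. ?w v i) * (C * ?det v))"
    by (rule sum.mono_neutral_left) (use finite_interlacing[of "Suc k" l] z zero in auto)
  also have "\<dots> = C * (\<Sum>v\<in>interlacing l. (\<Prod>i\<le>k. ?w v i) * ?det v)"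
    by (simp add: sum_distrib_left mult.left_commute)
  also have "(\<Sum>v\<in>interlacing l. (\<Prod>i\<le>k. ?w v i) * ?det v) =
      det (mat (Suc k) (Suc k) (\<lambda>(i, j). (strip_series (a ?t) (b ?t) * F j) $ l i))"
    by (rule det_strip_series_mult[symmetric]) (use l z in auto)
  finally show ?thesis .
qed

text \<open>The shift \<open>p = l + \<delta>\<close> turns horizontal strips on \<open>l\<close>
  into interlacing \<open>w\<close> with \<open>p (Suc i) < w i\<close>. The other \<open>w\<close>
  contribute nothing: for \<open>i < k\<close> the value \<open>w i = p (Suc i)\<close> has weight
  \<open>b = 0\<close>, and \<open>w k = 0\<close> gives a zero row because every \<open>F j\<close>
  has constant term 0.\<close>

lemma symplectic_filling_sum_Suc:
  fixes F :: "nat \<Rightarrow> 'a::field fps"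
  assumes l: "\<And>i. l (Suc i) \<le> l i" and z: "\<And>i. k < i \<Longrightarrow> l i = 0" and kn: "k < n"
    and t: "2 * k + 2 \<le> Suc m" and F0: "\<And>j. F j $ 0 = 0"
    and hyp: "\<And>v. v \<in> interlacing l \<Longrightarrow>
      filling_sum a a a False symplectic_bound n m v =
        det (mat (Suc k) (Suc k) (\<lambda>(i, j). F j $ (v i + (Suc k - i))))"
  shows "filling_sum a a a False symplectic_bound n (Suc m) l =
    det (mat (Suc k) (Suc k) (\<lambda>(i, j). (strip_series (a (Suc m)) 0 * F j) $ (l i + (Suc k - i))))"
proof -
  let ?a = "a (Suc m)"
  define p where "p i = (if i \<le> k then l i + (Suc k - i) else 0)" for i
  let ?det = "\<lambda>v. det (mat (Suc k) (Suc k) (\<lambda>(i, j). F j $ v i))"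
  let ?S = "{w \<in> interlacing p. \<forall>i\<le>k. p (Suc i) < w i}"
  let ?w = "\<lambda>w i. if w i = p i then 1
    else (if i < k \<and> w i = p (Suc i) then 0 else ?a + 0) * ?a ^ (p i - w i - 1)"
  have p_strict: "p (Suc i) < p i" if "i \<le> k" for i
    using l[of i] that by (auto simp: p_def)
  have pz: "p i = 0" if "k < i" for i using that by (simp add: p_def)
  have vz: "v i = 0" if "v \<in> interlacing l" "k < i" for v i
    using that z[of i] by (auto simp: interlacing_def) (metis le_zero_eq)
  have R: "removable False symplectic_bound (Suc m) l = interlacing l"
  proof -
    have "symplectic_bound i d (Suc m)" if "d < l i" for i d
    proof -
      have "i \<le> k" using z[of i] that by (metis not_less not_less_zero)
      then show ?thesis using t by (simp add: symplectic_bound_def)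
    qed
    then show ?thesis by (auto simp: removable_def)
  qed
  have zero: "(\<Prod>i\<le>k. ?w w i) * ?det w = 0" if w: "w \<in> interlacing p - ?S" for w
  proof -
    obtain i where "i \<le> k" "\<not> p (Suc i) < w i" using w by blast
    then have i: "i \<le> k" "w i \<le> p (Suc i)" by simp_all
    moreover have "p (Suc i) \<le> w i" using that by (auto simp: interlacing_def)
    ultimately have wi: "w i = p (Suc i)" by simp
    show ?thesis
    proof (cases "i < k")
      case True
      then have "?w w i = 0" using wi p_strict[of i] by simp
      then have "\<exists>i\<in>{..k}. ?w w i = 0" using i by blast
      then have "(\<Prod>i\<le>k. ?w w i) = 0" by (rule prod_zero[rotated]) simp
      then show ?thesis by simp
    next
      case False
      then have "w k = 0" using wi i pz[of "Suc k"] by simp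
      then have "?det w = 0" using F0 by (intro det_mat_zero_row[of k]) auto
      then show ?thesis by simp
    qed
  qed
  have "filling_sum a a a False symplectic_bound n (Suc m) l =
      (\<Sum>v\<in>interlacing l. (\<Prod>i<n. row_weight ?a ?a ?a l v i) *
        filling_sum a a a False symplectic_bound n m v)"
    by (subst R[symmetric], rule filling_sum_Suc) (use l z kn in auto)
  also have "\<dots> =
      (\<Sum>v\<in>interlacing l. (\<Prod>i\<le>k. ?a ^ (l i - v i)) *
         det (mat (Suc k) (Suc k) (\<lambda>(i, j). F j $ (v i + (Suc k - i)))))"
  proof (rule sum.cong[OF refl])
    fix v assume v: "v \<in> interlacing l"
    have "row_weight ?a ?a ?a l v i = ?a ^ (l i - v i)" for i
    proof -
      have "v i \<le> l i" using v by (simp add: interlacing_def)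
      then show ?thesis by (auto simp: row_weight_def power_eq_if)
    qed
    then have "(\<Prod>i<n. row_weight ?a ?a ?a l v i) = (\<Prod>i<n. ?a ^ (l i - v i))" by simp
    also have "\<dots> = (\<Prod>i\<le>k. ?a ^ (l i - v i))"
      by (rule prod.mono_neutral_right) (use kn z in auto)
    finally show "(\<Prod>i<n. row_weight ?a ?a ?a l v i) * filling_sum a a a False symplectic_bound n m v =
       (\<Prod>i\<le>k. ?a ^ (l i - v i)) * det (mat (Suc k) (Suc k) (\<lambda>(i, j). F j $ (v i + (Suc k - i))))"
      using hyp[OF v] by simp
  qed
  also have "\<dots> = (\<Sum>w\<in>?S. (\<Prod>i\<le>k. ?w w i) * ?det w)"
  proof (rule sum.reindex_bij_witness[where j = "\<lambda>v i. if i \<le> k then v i + (Suc k - i) else 0"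
        and i = "\<lambda>w i. if i \<le> k then w i - (Suc k - i) else 0"])
    fix v assume v: "v \<in> interlacing l"
    let ?v = "\<lambda>i. if i \<le> k then v i + (Suc k - i) else 0"
    show "(\<lambda>i. if i \<le> k then ?v i - (Suc k - i) else 0) = v"
      using vz[OF v] by (auto simp: fun_eq_iff)
    have vl: "v i \<le> l i" "l (Suc i) \<le> v i" for i using v by (auto simp: interlacing_def)
    have gt: "p (Suc i) < ?v i" if "i \<le> k" for i
      using vl[of i] that by (auto simp: p_def)
    moreover have "?v i \<le> p i" for i using vl[of i] by (auto simp: p_def)
    moreover have "p (Suc i) \<le> ?v i" for i
      using gt[of i] pz[of "Suc i"] by (cases "i \<le> k") auto
    ultimately show "?v \<in> ?S" by (auto simp: interlacing_def)
    have "?w ?v i = ?a ^ (l i - v i)" if "i \<le> k" for i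
    proof -
      have "?v i \<noteq> p (Suc i)" using gt[OF that] by simp
      moreover have "p i - ?v i = l i - v i" using that by (simp add: p_def)
      moreover have "?v i = p i \<longleftrightarrow> v i = l i" using that by (simp add: p_def) linarith
      ultimately show ?thesis using vl[of i] that by (auto simp: power_eq_if)
    qed
    moreover have "mat (Suc k) (Suc k) (\<lambda>(i, j). F j $ ?v i) =
        mat (Suc k) (Suc k) (\<lambda>(i, j). F j $ (v i + (Suc k - i)))"
      by (rule eq_matI) auto
    ultimately show "(\<Prod>i\<le>k. ?w ?v i) * ?det ?v = (\<Prod>i\<le>k. ?a ^ (l i - v i)) *
        det (mat (Suc k) (Suc k) (\<lambda>(i, j). F j $ (v i + (Suc k - i))))"
      by simp
  next
    fix w assume w: "w \<in> ?S"
    let ?v = "\<lambda>i. if i \<le> k then w i - (Suc k - i) else 0"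
    have wp: "w i \<le> p i" for i using w by (auto simp: interlacing_def)
    have gt: "p (Suc i) < w i" if "i \<le> k" for i using w that by simp
    have ge: "l (Suc i) + (Suc k - i) \<le> w i" if "i \<le> k" for i
      using gt[OF that] that z[of "Suc i"] by (cases "i = k") (auto simp: p_def)
    show "(\<lambda>i. if i \<le> k then ?v i + (Suc k - i) else 0) = w"
    proof
      fix i show "(if i \<le> k then ?v i + (Suc k - i) else 0) = w i"
        using ge[of i] wp[of i] pz[of i] by (cases "i \<le> k") auto
    qed
    have "l (Suc i) \<le> ?v i \<and> ?v i \<le> l i" for i
      using ge[of i] wp[of i] z[of "Suc i"] by (cases "i \<le> k") (auto simp: p_def)
    then show "?v \<in> interlacing l" by (auto simp: interlacing_def)
  qed
  also have "\<dots> = (\<Sum>w\<in>interlacing p. (\<Prod>i\<le>k. ?w w i) * ?det w)"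
    by (rule sum.mono_neutral_left) (use finite_interlacing[of "Suc k" p] pz zero in auto)
  also have "\<dots> = det (mat (Suc k) (Suc k) (\<lambda>(i, j). (strip_series ?a 0 * F j) $ p i))"
    by (rule det_strip_series_mult[symmetric]) (use p_strict pz in auto)
  also have "mat (Suc k) (Suc k) (\<lambda>(i, j). (strip_series ?a 0 * F j) $ p i) =
     mat (Suc k) (Suc k) (\<lambda>(i, j). (strip_series ?a 0 * F j) $ (l i + (Suc k - i)))"
    by (rule eq_matI) (auto simp: p_def)
  finally show ?thesis .
qed

text \<open>Reciprocal of the series of one-row strips in the letters of weight \<open>z\<close> and \<open>1/z\<close>; after division
  by \<open>X\<close> it is \<open>X + 1/X - (z + 1/z)\<close>.\<close>

definition pair_series :: "'a::field \<Rightarrow> 'a fps" where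
  "pair_series z = 1 - fps_const (z + inverse z) * fps_X + fps_X ^ 2"

text \<open>Each factor is \<open>1/(u - X\<^sub>r\<^sub>+\<^sub>1)\<close> in terms of
  \<open>u = X + 1/X\<close>. As indices start at 0 here, this is the series
  \<open>N\<^sub>j\<^sub>+\<^sub>1\<close> for the letters of index up to \<open>k\<close>.\<close>

definition column_series :: "(nat \<Rightarrow> 'a::field) \<Rightarrow> nat \<Rightarrow> nat \<Rightarrow> 'a fps" where
  "column_series x k j = (\<Prod>r=j..<k. fps_X * inverse (pair_series (x (Suc r))))"

section \<open>Algebra of the pair and column series\<close>

lemma pair_series_inverse: "inverse (pair_series z) * pair_series z = 1"
  by (rule inverse_mult_eq_1) (simp add: pair_series_def)

lemma linear_series_mult:
  fixes w w' :: "'a::field"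
  shows "(1 + fps_const w * fps_X) * (1 + fps_const w' * fps_X) =
    1 + fps_const (w + w') * fps_X + fps_const (w * w') * fps_X ^ 2"
proof -
  have "(1 + A * X) * (1 + B * X) = 1 + (A + B) * X + (A * B) * X ^ 2" for A B X :: "'a fps"
    by (simp add: algebra_simps power2_eq_square)
  then show ?thesis unfolding fps_const_add[symmetric] fps_const_mult[symmetric] .
qed

lemma pair_series_factor:
  assumes "z \<noteq> 0"
  shows "(1 - fps_const z * fps_X) * (1 - fps_const (inverse z) * fps_X) = pair_series z"
proof -
  have "(1 - A * X) * (1 - B * X) = 1 - (A + B) * X + (A * B) * X ^ 2" for A B X :: "'a fps"
    by (simp add: algebra_simps power2_eq_square)
  then show ?thesis using assms by (simp add: pair_series_def)
qed

lemma strip_series_pair: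
  assumes "z \<noteq> 0"
  shows "strip_series z w * strip_series (inverse z) w' * pair_series z =
    (1 + fps_const w * fps_X) * (1 + fps_const w' * fps_X)"
proof -
  have "strip_series z w * strip_series (inverse z) w' * pair_series z =
    (strip_series z w * (1 - fps_const z * fps_X)) *
    (strip_series (inverse z) w' * (1 - fps_const (inverse z) * fps_X))"
    unfolding pair_series_factor[OF assms, symmetric] by (simp only: mult_ac)
  then show ?thesis by (simp only: strip_series_mult)
qed

lemma strip_series_pair_zero:
  assumes "z \<noteq> 0"
  shows "strip_series (inverse z) 0 * (strip_series z 0 * F) = F * inverse (pair_series z)"
proof -
  let ?s = "strip_series z 0 * strip_series (inverse z) 0"
  have s: "?s * pair_series z = 1" using strip_series_pair[OF assms, of 0 0] by simp
  have "strip_series (inverse z) 0 * (strip_series z 0 * F) =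
      (?s * F) * (inverse (pair_series z) * pair_series z)"
    by (subst pair_series_inverse) (simp only: mult_1 mult_1_right mult_ac)
  also have "\<dots> = (?s * pair_series z) * (F * inverse (pair_series z))"
    by (simp only: mult_ac)
  finally show ?thesis by (simp only: s mult_1)
qed

lemma column_series_self: "column_series x k k = 1"
  by (simp add: column_series_def)

lemma column_series_Suc:
  "j \<le> k \<Longrightarrow> column_series x (Suc k) j = column_series x k j * (fps_X * inverse (pair_series (x (Suc k))))"
  by (simp add: column_series_def)

lemma column_series_first:
  "j < k \<Longrightarrow> column_series x k j = fps_X * inverse (pair_series (x (Suc j))) * column_series x k (Suc j)"
  by (simp add: column_series_def prod.atLeast_Suc_lessThan)

text \<open>The product of the two strip series is
  \<open>(u + Y)/(u - X\<^sub>k\<^sub>+\<^sub>1)\<close>, whose denominator supplies the new factor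
  of the column. Writing \<open>u + Y\<close> as \<open>(u - X\<^sub>j\<^sub>+\<^sub>1) +
  (X\<^sub>j\<^sub>+\<^sub>1 + Y)\<close>, the first summand cancels the leading factor of the
  column and the second is a constant.\<close>

lemma strip_series_pair_column:
  assumes x: "x (Suc k) \<noteq> 0" and y: "y \<noteq> 0" and j: "j \<le> k"
  shows "strip_series (inverse (x (Suc k))) (inverse y) * (strip_series (x (Suc k)) y * column_series x k j) =
    column_series x (Suc k) (Suc j) +
      fps_const (x (Suc j) + inverse (x (Suc j)) + y + inverse y) * column_series x (Suc k) j"
proof -
  let ?z = "x (Suc k)"
  let ?c = "x (Suc j) + inverse (x (Suc j)) + y + inverse y"
  let ?E = "column_series x (Suc k) (Suc j)"
  have y2: "(1 + fps_const y * fps_X) * (1 + fps_const (inverse y) * fps_X) =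
      pair_series (x (Suc j)) + fps_const ?c * fps_X"
    unfolding linear_series_mult using y
    by (simp add: pair_series_def algebra_simps fps_const_add[symmetric] del: fps_const_add)
  have first: "column_series x (Suc k) j * pair_series (x (Suc j)) = fps_X * ?E"
  proof -
    have "column_series x (Suc k) j * pair_series (x (Suc j)) =
        (inverse (pair_series (x (Suc j))) * pair_series (x (Suc j))) * (fps_X * ?E)"
      using column_series_first[of j "Suc k" x] j by (simp only: mult_ac less_Suc_eq_le)
    then show ?thesis by (simp only: pair_series_inverse mult_1)
  qed
  define S where "S = strip_series ?z y * strip_series (inverse ?z) (inverse y)"
  have S: "S * pair_series ?z = pair_series (x (Suc j)) + fps_const ?c * fps_X"
    unfolding S_def strip_series_pair[OF x] y2 ..
  \<comment> \<open>The series ring has no \<open>1/X\<close>, so the identity is proved after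
    multiplication by \<open>fps_X\<close>, which is then cancelled.\<close>
  have "fps_X * (S * column_series x k j) =
      fps_X * (S * column_series x k j * (inverse (pair_series ?z) * pair_series ?z))"
    by (simp only: pair_series_inverse mult_1_right)
  also have "\<dots> = (S * pair_series ?z) * column_series x (Suc k) j"
    unfolding column_series_Suc[OF j] by (simp only: mult_ac)
  also have "\<dots> = fps_X * (?E + fps_const ?c * column_series x (Suc k) j)"
    unfolding S distrib_right mult.commute[of "pair_series (x (Suc j))"] first by (simp only: distrib_left mult_ac)
  finally have "S * column_series x k j = ?E + fps_const ?c * column_series x (Suc k) j"
    by simp
  then show ?thesis unfolding S_def by (simp only: mult_ac)
qed

text \<open>Induction on the index \<open>k\<close>; \<open>2 * k + 1\<close> is the rank of
  \<open>Bar k\<close>, and a step adds the ranks \<open>2 * k + 2\<close> and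
  \<open>2 * k + 3\<close>. Before these are added, the determinant of size \<open>k\<close> is
  rewritten as one of size \<open>k + 1\<close>.\<close>

lemma symplectic_filling_sum_det:
  fixes x a :: "nat \<Rightarrow> 'a::field"
  assumes a: "\<And>r. r < n \<Longrightarrow> a (2 * r + 2) = x (Suc r) \<and> a (2 * r + 3) = inverse (x (Suc r))"
    and x: "\<And>r. r < n \<Longrightarrow> x (Suc r) \<noteq> 0"
  shows "k \<le> n \<Longrightarrow> (\<And>i. l (Suc i) \<le> l i) \<Longrightarrow> (\<And>i. k \<le> i \<Longrightarrow> l i = 0) \<Longrightarrow>
    filling_sum a a a False symplectic_bound n (2 * k + 1) l =
      det (mat k k (\<lambda>(i, j). column_series x k j $ (l i + (k - i))))"
proof (induction k arbitrary: l)
  case 0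
  then have "l = (\<lambda>_. 0)" by (auto simp: fun_eq_iff)
  then show ?case by (simp add: filling_sum_empty_shape)
next
  case (Suc k)
  let ?X = "\<lambda>j. fps_X * column_series x k j"
  have kn: "k < n" using Suc.prems by simp
  have step1: "filling_sum a a a False symplectic_bound n (Suc (2 * k + 1)) v =
    det (mat (Suc k) (Suc k) (\<lambda>(i, j). (strip_series (a (Suc (2 * k + 1))) 0 * ?X j) $ (v i + (Suc k - i))))"
    if v: "\<And>i. v (Suc i) \<le> v i" "\<And>i. k < i \<Longrightarrow> v i = 0" for v
  proof (rule symplectic_filling_sum_Suc)
    fix w assume "w \<in> interlacing v"
    then have w: "\<And>i. v (Suc i) \<le> w i" "\<And>i. w i \<le> v i" by (auto simp: interlacing_def)
    \<comment> \<open>The factor \<open>fps_X\<close> absorbs the change of the staircase from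
      \<open>k - i\<close> to \<open>Suc k - i\<close>. The new last column comes from the constant
      series 1, so it is nonzero only in row \<open>k\<close>, and there only if
      \<open>w k = 0\<close>.\<close>
    have "mat (Suc k) (Suc k) (\<lambda>(i, j). ?X j $ (w i + (Suc k - i))) =
       mat (Suc k) (Suc k) (\<lambda>(i, j). column_series x k j $ (w i + (k - i)))"
      by (rule eq_matI) (auto simp: Suc_diff_le)
    also have "det \<dots> = column_series x k k $ (w k + (k - k)) *
        det (mat k k (\<lambda>(i, j). column_series x k j $ (w i + (k - i))))"
      by (rule det_mat_last_column) (simp add: column_series_self)
    also have "\<dots> = filling_sum a a a False symplectic_bound n (2 * k + 1) w"
    proof (cases "w k = 0")
      case True
      have "filling_sum a a a False symplectic_bound n (2 * k + 1) w =
          det (mat k k (\<lambda>(i, j). column_series x k j $ (w i + (k - i))))"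
      proof (rule Suc.IH)
        fix i show "w (Suc i) \<le> w i" using w[of i] w[of "Suc i"] by simp
        assume "k \<le> i" then show "w i = 0" using True w(2)[of i] v(2)[of i] by (cases "i = k") auto
      qed (use kn in simp)
      then show ?thesis using True by (simp add: column_series_self)
    next
      \<comment> \<open>A nonempty row \<open>k\<close> needs an entry of rank at least
        \<open>2 * k + 2\<close>, so both sides vanish.\<close>
      case False
      then have "filling_sum a a a False symplectic_bound n (2 * k + 1) w = 0"
        by (intro filling_sum_eq_0[of _ k]) (auto simp: symplectic_bound_def)
      then show ?thesis using False by (simp add: column_series_self)
    qed
    finally show "filling_sum a a a False symplectic_bound n (2 * k + 1) w =
        det (mat (Suc k) (Suc k) (\<lambda>(i, j). ?X j $ (w i + (Suc k - i))))" ..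
  qed (use v kn in auto)
  have "filling_sum a a a False symplectic_bound n (Suc (Suc (2 * k + 1))) l =
    det (mat (Suc k) (Suc k) (\<lambda>(i, j). (strip_series (a (Suc (Suc (2 * k + 1)))) 0 *
      (strip_series (a (Suc (2 * k + 1))) 0 * ?X j)) $ (l i + (Suc k - i))))"
  proof (rule symplectic_filling_sum_Suc)
    fix v assume "v \<in> interlacing l"
    then have v: "\<And>i. l (Suc i) \<le> v i" "\<And>i. v i \<le> l i" by (auto simp: interlacing_def)
    have "v (Suc i) \<le> v i" for i using v[of i] v[of "Suc i"] by simp
    moreover have "v i = 0" if "k < i" for i using v(2)[of i] Suc.prems(3)[of i] that by simp
    ultimately show "filling_sum a a a False symplectic_bound n (Suc (2 * k + 1)) v =
      det (mat (Suc k) (Suc k) (\<lambda>(i, j). (strip_series (a (Suc (2 * k + 1))) 0 * ?X j) $ (v i + (Suc k - i))))"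
      by (rule step1)
  qed (use Suc.prems kn in auto)
  also have "mat (Suc k) (Suc k) (\<lambda>(i, j). (strip_series (a (Suc (Suc (2 * k + 1)))) 0 *
      (strip_series (a (Suc (2 * k + 1))) 0 * ?X j)) $ (l i + (Suc k - i))) =
    mat (Suc k) (Suc k) (\<lambda>(i, j). column_series x (Suc k) j $ (l i + (Suc k - i)))"
  proof (rule eq_matI, goal_cases)
    case (1 i j)
    then have j: "j \<le> k" by simp
    have "strip_series (inverse (x (Suc k))) 0 * (strip_series (x (Suc k)) 0 * ?X j) = column_series x (Suc k) j"
      unfolding strip_series_pair_zero[OF x[OF kn]] column_series_Suc[OF j] by (simp only: mult_ac)
    then show ?case using 1 a[OF kn] by (simp add: numeral_eq_Suc)
  qed auto
  finally show ?case by simp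
qed

text \<open>The same induction, with strict shapes in place of the staircase shift. The two letters
  of index \<open>k + 1\<close> now change the columns by a bidiagonal matrix, whose determinant is
  the product of the new factors.\<close>

lemma shifted_filling_sum_det:
  fixes x y a b :: "nat \<Rightarrow> 'a::field"
  assumes a: "\<And>r. r < n \<Longrightarrow> a (2 * r + 2) = x (Suc r) \<and> a (2 * r + 3) = inverse (x (Suc r))"
    and b: "\<And>r. r < n \<Longrightarrow> b (2 * r + 2) = y (Suc r) \<and> b (2 * r + 3) = inverse (y (Suc r))"
    and x: "\<And>r. r < n \<Longrightarrow> x (Suc r) \<noteq> 0"
    and y: "\<And>r. r < n \<Longrightarrow> y (Suc r) \<noteq> 0"
  shows "k \<le> n \<Longrightarrow> (\<And>i. i < k \<Longrightarrow> l (Suc i) < l i) \<Longrightarrow> (\<And>i. k \<le> i \<Longrightarrow> l i = 0) \<Longrightarrow>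
    filling_sum a b (\<lambda>t. a t + b t) True starts_on_diagonal n (2 * k + 1) l =
      (\<Prod>s<k. \<Prod>r\<le>s. x (Suc r) + inverse (x (Suc r)) + y (Suc s) + inverse (y (Suc s))) *
      det (mat k k (\<lambda>(i, j). column_series x k j $ l i))"
proof (induction k arbitrary: l)
  case 0
  then have "l = (\<lambda>_. 0)" by (auto simp: fun_eq_iff)
  then show ?case by (simp add: filling_sum_empty_shape)
next
  case (Suc k)
  let ?c = "\<lambda>s r. x (Suc r) + inverse (x (Suc r)) + y (Suc s) + inverse (y (Suc s))"
  let ?C = "\<Prod>s<k. \<Prod>r\<le>s. ?c s r"
  let ?Z = "filling_sum a b (\<lambda>t. a t + b t) True starts_on_diagonal n"
  let ?F = "\<lambda>j. column_series x k j"
  let ?t = "Suc (2 * k + 1)"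
  have kn: "k < n" using Suc.prems by simp
  have step1: "?Z ?t v = ?C * det (mat (Suc k) (Suc k) (\<lambda>(i, j). (strip_series (a ?t) (b ?t) * ?F j) $ v i))"
    if v: "\<And>i. i < k \<Longrightarrow> v (Suc i) < v i" "\<And>i. k < i \<Longrightarrow> v i = 0" for v
  proof (rule shifted_filling_sum_Suc)
    fix w assume "w \<in> interlacing v" and ws: "\<And>i. i < k \<Longrightarrow> w (Suc i) < w i"
    then have w: "\<And>i. v (Suc i) \<le> w i" "\<And>i. w i \<le> v i" by (auto simp: interlacing_def)
    have "det (mat (Suc k) (Suc k) (\<lambda>(i, j). ?F j $ w i)) =
        ?F k $ w k * det (mat k k (\<lambda>(i, j). ?F j $ w i))"
    proof (rule det_mat_last_column)
      fix i assume "i < k"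
      then show "?F k $ w i = 0" using ws[of i] by (simp add: column_series_self)
    qed
    also have "?C * \<dots> = ?Z (2 * k + 1) w"
    proof (cases "w k = 0")
      case True
      have "?Z (2 * k + 1) w = ?C * det (mat k k (\<lambda>(i, j). ?F j $ w i))"
      proof (rule Suc.IH)
        fix i assume "k \<le> i" then show "w i = 0" using True w(2)[of i] v(2)[of i] by (cases "i = k") auto
      qed (use kn ws in auto)
      then show ?thesis using True by (simp add: column_series_self)
    next
      case False
      then have "?Z (2 * k + 1) w = 0"
        by (intro filling_sum_eq_0[of _ k]) (auto simp: starts_on_diagonal_def)
      then show ?thesis using False by (simp add: column_series_self)
    qed
    finally show "?Z (2 * k + 1) w = ?C * det (mat (Suc k) (Suc k) (\<lambda>(i, j). ?F j $ w i))" ..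
  qed (use v kn in auto)
  have "?Z (Suc ?t) l = ?C * det (mat (Suc k) (Suc k)
      (\<lambda>(i, j). (strip_series (a (Suc ?t)) (b (Suc ?t)) * (strip_series (a ?t) (b ?t) * ?F j)) $ l i))"
  proof (rule shifted_filling_sum_Suc)
    fix v assume "v \<in> interlacing l" and vs: "\<And>i. i < k \<Longrightarrow> v (Suc i) < v i"
    then have v: "\<And>i. v i \<le> l i" by (auto simp: interlacing_def)
    have "v i = 0" if "k < i" for i using v[of i] Suc.prems(3)[of i] that by simp
    then show "?Z ?t v = ?C * det (mat (Suc k) (Suc k) (\<lambda>(i, j). (strip_series (a ?t) (b ?t) * ?F j) $ v i))"
      using vs by (intro step1) auto
  qed (use Suc.prems kn in auto)
  also have "mat (Suc k) (Suc k)
      (\<lambda>(i, j). (strip_series (a (Suc ?t)) (b (Suc ?t)) * (strip_series (a ?t) (b ?t) * ?F j)) $ l i) =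
    mat (Suc k) (Suc k) (\<lambda>(i, j). column_series x (Suc k) (Suc j) $ l i + ?c k j * column_series x (Suc k) j $ l i)"
  proof (rule eq_matI, goal_cases)
    case (1 i j)
    then have j: "j \<le> k" by simp
    show ?case using 1 a[OF kn] b[OF kn] strip_series_pair_column[of x k "y (Suc k)" j, OF x[OF kn] y[OF kn] j]
      by (simp add: numeral_eq_Suc)
  qed auto
  \<comment> \<open>The column beyond the last comes from the constant series 1, and its entries
    vanish because strictness makes every \<open>l i\<close> with \<open>i \<le> k\<close>
    positive.\<close>
  also have "det \<dots> = (\<Prod>j<Suc k. ?c k j) * det (mat (Suc k) (Suc k) (\<lambda>(i, j). column_series x (Suc k) j $ l i))"
  proof (rule det_mat_add_next_column)
    fix i assume "i < Suc k"
    then have "0 < l i" using Suc.prems(2)[of i] by simp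
    then show "column_series x (Suc k) (Suc k) $ l i = 0" by (simp add: column_series_self)
  qed
  also have "?C * ((\<Prod>j<Suc k. ?c k j) * det (mat (Suc k) (Suc k) (\<lambda>(i, j). column_series x (Suc k) j $ l i))) =
      (\<Prod>s<Suc k. \<Prod>r\<le>s. ?c s r) * det (mat (Suc k) (Suc k) (\<lambda>(i, j). column_series x (Suc k) j $ l i))"
    by (subst (2) prod.lessThan_Suc) (simp only: lessThan_Suc_atMost mult.assoc)
  finally show ?case by (simp only: mult_Suc_right add_Suc add_Suc_right add_0 numeral_2_eq_2 One_nat_def)
qed

section \<open>Tableaux as fillings\<close>

text \<open>Ranks 0 and 1 give \<open>Plain 0\<close> and \<open>Bar 0\<close>, which lie in no
  alphabet; the letters of \<open>alphabet n\<close> have ranks 2 to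
  \<open>2 * n + 1\<close>.\<close>

definition letter_of :: "nat \<Rightarrow> letter" where
  "letter_of t = (if even t then Plain (t div 2) else Bar (t div 2))"

lemma letter_of_rank: "letter_of (letter_rank c) = c"
  by (cases c) (auto simp: letter_of_def)

lemma letter_rank_of: "letter_rank (letter_of t) = t"
  by (auto simp: letter_of_def elim: oddE)

lemma alphabet_iff: "c \<in> alphabet n \<longleftrightarrow> 2 \<le> letter_rank c \<and> letter_rank c \<le> 2 * n + 1"
  by (cases c) (auto simp: alphabet_def)

lemma letter_of_alphabet: "letter_of t \<in> alphabet n \<longleftrightarrow> 2 \<le> t \<and> t \<le> 2 * n + 1"
  by (simp add: alphabet_iff letter_rank_of)

text \<open>With three equal weight functions \<open>cell_weight\<close> does not see the
  neighbours. The lower bound 2 on ranks, needed for membership in the alphabet, is implied by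
  \<open>symplectic_bound\<close>.\<close>

lemma symplectic_character_eq_filling_sum:
  assumes n: "\<And>i. n \<le> i \<Longrightarrow> \<mu> (Suc i) = 0" and dec: "\<And>i. \<mu> (Suc (Suc i)) \<le> \<mu> (Suc i)"
  shows "symplectic_character n \<mu> x =
    filling_sum (\<lambda>t. letter_weight x (letter_of t)) (\<lambda>t. letter_weight x (letter_of t))
      (\<lambda>t. letter_weight x (letter_of t)) False symplectic_bound n (2 * n + 1) (\<lambda>i. \<mu> (Suc i))"
proof -
  let ?l = "\<lambda>i. \<mu> (Suc i)" and ?a = "\<lambda>t. letter_weight x (letter_of t)"
  define rk where "rk T i d = (if d < ?l i then letter_rank (T (Suc i, Suc d)) else 0)" for T i d
  define tab where "tab U = (\<lambda>(i, j). if (i, j) \<in> young_diagram \<mu> then letter_of (U (i - 1) (j - 1)) else undefined)"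
    for U :: "nat \<Rightarrow> nat \<Rightarrow> nat"
  have D: "(Suc i, Suc d) \<in> young_diagram \<mu> \<longleftrightarrow> d < ?l i" for i d
    by (auto simp: young_diagram_def)
  have D_cases: "\<exists>i' d. i = Suc i' \<and> j = Suc d \<and> d < ?l i'" if "(i, j) \<in> young_diagram \<mu>" for i j
    using that by (cases i; cases j) (auto simp: young_diagram_def)
  have tabD: "tab U (Suc i, Suc d) = letter_of (U i d)" if "d < ?l i" for U i d
    using that D[of i d] by (simp add: tab_def)
  have rkD: "rk T i d = letter_rank (T (Suc i, Suc d))" if "d < ?l i" for T i d
    using that by (simp add: rk_def)
  have lt: "i < n" if "d < ?l i" for i d using n[of i] that by (cases "i < n") auto
  have dlt: "d < ?l i" if "d < ?l (Suc i)" for i d using dec[of i] that by simp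
  have image: "young_diagram \<mu> = (\<lambda>(i, d). (Suc i, Suc d)) ` Sigma {..<n} (\<lambda>i. {..<?l i})"
  proof (intro equalityI subsetI)
    fix z assume z: "z \<in> young_diagram \<mu>"
    obtain i j where ij: "z = (i, j)" by force
    then obtain i' d where "i = Suc i'" "j = Suc d" "d < ?l i'" using D_cases z by blast
    then show "z \<in> (\<lambda>(i, d). (Suc i, Suc d)) ` Sigma {..<n} (\<lambda>i. {..<?l i})"
      using ij lt by (intro image_eqI[of _ _ "(i', d)"]) auto
  qed (use D in auto)
  show ?thesis
    unfolding symplectic_character_def filling_sum_def
  proof (rule sum.reindex_bij_witness[where i = "tab" and j = rk])
    fix T assume T: "T \<in> symplectic_tableaux n \<mu>"
    then have TE: "T \<in> young_diagram \<mu> \<rightarrow>\<^sub>E alphabet n"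
      and T1: "\<And>i j. (i, j) \<in> young_diagram \<mu> \<Longrightarrow> (i, j + 1) \<in> young_diagram \<mu> \<Longrightarrow> T (i, j) \<le> T (i, j + 1)"
      and T2: "\<And>i j. (i, j) \<in> young_diagram \<mu> \<Longrightarrow> (i + 1, j) \<in> young_diagram \<mu> \<Longrightarrow> T (i, j) < T (i + 1, j)"
      and T3: "\<And>r j. (r, j) \<in> young_diagram \<mu> \<Longrightarrow> Plain r \<le> T (r, j)"
      by (auto simp: symplectic_tableaux_def)
    show "tab (rk T) = T"
    proof
      fix z :: "nat \<times> nat"
      obtain i j where z: "z = (i, j)" by force
      show "tab (rk T) z = T z"
      proof (cases "(i, j) \<in> young_diagram \<mu>")
        case True
        then obtain i' d where "i = Suc i'" "j = Suc d" "d < ?l i'" using D_cases by blast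
        then show ?thesis using z by (simp add: tabD rkD letter_of_rank)
      next
        case False
        then show ?thesis using z TE PiE_arb[OF TE, of z] by (simp add: tab_def)
      qed
    qed
    show "rk T \<in> fillings False symplectic_bound (2 * n + 1) ?l"
      unfolding fillings_def mem_Collect_eq
    proof (intro conjI allI impI, goal_cases)
      case (1 i d)
      then show ?case using PiE_mem[OF TE, of "(Suc i, Suc d)"] D[of i d] by (simp add: rkD alphabet_iff)
    next
      case (2 i d)
      then show ?case using T3[of "Suc i" "Suc d"] D[of i d] by (simp add: rkD symplectic_bound_def less_eq_letter_def)
    next
      case (4 i d)
      then show ?case using T1[of "Suc i" "Suc d"] D[of i d] D[of i "Suc d"] by (simp add: rkD less_eq_letter_def)
    next
      case (5 i d)
      then show ?case using T2[of "Suc i" "Suc d"] D[of i d] D[of "Suc i" d] dlt[OF 5] by (simp add: rkD less_letter_def)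
    qed (auto simp: rk_def)
    have "(\<Prod>b\<in>young_diagram \<mu>. letter_weight x (T b)) =
        (\<Prod>(i, d)\<in>Sigma {..<n} (\<lambda>i. {..<?l i}). letter_weight x (T (Suc i, Suc d)))"
      unfolding image by (subst prod.reindex) (auto simp: inj_on_def intro!: prod.cong)
    also have "\<dots> = (\<Prod>i<n. \<Prod>d<?l i. letter_weight x (T (Suc i, Suc d)))"
      by (rule prod.Sigma[symmetric]) auto
    also have "\<dots> = (\<Prod>i<n. \<Prod>d<?l i. cell_weight ?a ?a ?a ?l (rk T) i d)"
      by (intro prod.cong refl) (simp add: cell_weight_def rkD letter_of_rank)
    finally show "(\<Prod>i<n. \<Prod>d<?l i. cell_weight ?a ?a ?a ?l (rk T) i d) =
        (\<Prod>b\<in>young_diagram \<mu>. letter_weight x (T b))" ..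
  next
    fix U assume U: "U \<in> fillings False symplectic_bound (2 * n + 1) ?l"
    then have U1: "\<And>i d. d < ?l i \<Longrightarrow> U i d \<le> 2 * n + 1 \<and> 2 * i + 2 \<le> U i d"
      and U0: "\<And>i d. \<not> d < ?l i \<Longrightarrow> U i d = 0"
      and U2: "\<And>i d. Suc d < ?l i \<Longrightarrow> U i d \<le> U i (Suc d)"
      and U3: "\<And>i d. d < ?l (Suc i) \<Longrightarrow> U i d < U (Suc i) d"
      by (auto simp: fillings_def symplectic_bound_def)
    show "rk (tab U) = U"
    proof (intro ext)
      fix i d show "rk (tab U) i d = U i d"
        using U0[of d i] tabD[of d i U] by (auto simp: rk_def letter_rank_of)
    qed
    show "tab U \<in> symplectic_tableaux n \<mu>"
      unfolding symplectic_tableaux_def mem_Collect_eq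
    proof (intro conjI allI impI)
      show "tab U \<in> young_diagram \<mu> \<rightarrow>\<^sub>E alphabet n"
      proof (rule PiE_I)
        fix z assume z: "z \<in> young_diagram \<mu>"
        obtain i j where ij: "z = (i, j)" by force
        then obtain i' d where "i = Suc i'" "j = Suc d" "d < ?l i'" using D_cases z by blast
        then show "tab U z \<in> alphabet n" using ij U1[of d i'] by (simp add: tabD letter_of_alphabet)
      qed (auto simp: tab_def)
    next
      fix i j assume *: "(i, j) \<in> young_diagram \<mu> \<and> (i, j + 1) \<in> young_diagram \<mu>"
      then obtain i' d where "i = Suc i'" "j = Suc d" "d < ?l i'" using D_cases by blast
      then show "tab U (i, j) \<le> tab U (i, j + 1)"
        using * U2[of d i'] D[of i' "Suc d"] by (simp add: tabD less_eq_letter_def letter_rank_of)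
    next
      fix i j assume *: "(i, j) \<in> young_diagram \<mu> \<and> (i + 1, j) \<in> young_diagram \<mu>"
      then obtain i' d where "i = Suc i'" "j = Suc d" "d < ?l i'" using D_cases by blast
      then show "tab U (i, j) < tab U (i + 1, j)"
        using * U3[of d i'] D[of "Suc i'" d] by (simp add: tabD less_letter_def letter_rank_of)
    next
      show "\<forall>(r, j)\<in>young_diagram \<mu>. Plain r \<le> tab U (r, j)"
      proof (clarify)
        fix r j assume "(r, j) \<in> young_diagram \<mu>"
        then obtain i' d where "r = Suc i'" "j = Suc d" "d < ?l i'" using D_cases by blast
        then show "Plain r \<le> tab U (r, j)"
          using U1[of d i'] by (simp add: tabD less_eq_letter_def letter_rank_of)
      qed
    qed
  qed
qed

text \<open>Cell \<open>(i, d)\<close> is the box \<open>(i + 1, i + d + 1)\<close>. Hence the box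
  below it is cell \<open>(i + 1, d - 1)\<close>, and its diagonal successor is cell
  \<open>(i + 1, d)\<close>.\<close>

lemma shifted_tableaux_sum_eq_filling_sum:
  fixes la :: "nat \<Rightarrow> nat"
  assumes n: "\<And>i. n \<le> i \<Longrightarrow> la (Suc i) = 0" and dec: "\<And>i. la (Suc (Suc i)) \<le> la (Suc i)"
    and pos: "\<And>i. i < n \<Longrightarrow> 0 < la (Suc i)"
  shows "shifted_tableaux_sum n la x y =
    filling_sum (\<lambda>t. letter_weight x (letter_of t)) (\<lambda>t. letter_weight y (letter_of t))
      (\<lambda>t. letter_weight x (letter_of t) + letter_weight y (letter_of t)) True starts_on_diagonal n
      (2 * n + 1) (\<lambda>i. la (Suc i))"
proof -
  let ?l = "\<lambda>i. la (Suc i)" and ?a = "\<lambda>t. letter_weight x (letter_of t)" and ?b = "\<lambda>t. letter_weight y (letter_of t)"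
  let ?D = "shifted_diagram n la"
  define rk where "rk T i d = (if d < ?l i then letter_rank (T (Suc i, Suc i + d)) else 0)" for T i d
  define tab where "tab U = (\<lambda>(i, j). if (i, j) \<in> ?D then letter_of (U (i - 1) (j - i)) else undefined)"
    for U :: "nat \<Rightarrow> nat \<Rightarrow> nat"
  have lt: "i < n" if "d < ?l i" for i d using n[of i] that by (cases "i < n") auto
  have D: "(Suc i, Suc (i + d)) \<in> ?D \<longleftrightarrow> d < ?l i" for i d
    using lt[of d i] by (auto simp: shifted_diagram_def)
  have D_cases: "\<exists>i' d. i = Suc i' \<and> j = Suc (i' + d) \<and> d < ?l i'" if ij: "(i, j) \<in> ?D" for i j
  proof -
    obtain i' where i: "i = Suc i'" using ij by (cases i) (auto simp: shifted_diagram_def)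
    have "j = Suc (i' + (j - i))" using that i by (auto simp: shifted_diagram_def)
    then show ?thesis using that i D[of i' "j - i"] by metis
  qed
  have tabD: "tab U (Suc i, Suc (i + d)) = letter_of (U i d)" if "d < ?l i" for U i d
    using that D[of i d] by (simp add: tab_def)
  have rkD: "rk T i d = letter_rank (T (Suc i, Suc (i + d)))" if "d < ?l i" for T i d
    using that by (simp add: rk_def)
  have dlt: "d < ?l i" if "d < ?l (Suc i)" for i d using dec[of i] that by simp
  have image: "?D = (\<lambda>(i, d). (Suc i, Suc (i + d))) ` Sigma {..<n} (\<lambda>i. {..<?l i})"
  proof (intro equalityI subsetI)
    fix z assume z: "z \<in> ?D"
    obtain i j where ij: "z = (i, j)" by force
    then obtain i' d where "i = Suc i'" "j = Suc (i' + d)" "d < ?l i'" using D_cases z by blast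
    then show "z \<in> (\<lambda>(i, d). (Suc i, Suc (i + d))) ` Sigma {..<n} (\<lambda>i. {..<?l i})"
      using ij lt by (intro image_eqI[of _ _ "(i', d)"]) auto
  qed (use D in auto)
  show ?thesis
    unfolding shifted_tableaux_sum_def filling_sum_def
  proof (rule sum.reindex_bij_witness[where i = "tab" and j = rk])
    fix T assume T: "T \<in> symplectic_shifted_tableaux n la"
    then have TE: "T \<in> ?D \<rightarrow>\<^sub>E alphabet n"
      and T1: "\<And>i j. (i, j) \<in> ?D \<Longrightarrow> (i, j + 1) \<in> ?D \<Longrightarrow> T (i, j) \<le> T (i, j + 1)"
      and T2: "\<And>i j. (i, j) \<in> ?D \<Longrightarrow> (i + 1, j) \<in> ?D \<Longrightarrow> T (i, j) \<le> T (i + 1, j)"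
      and T3: "\<And>i j. (i, j) \<in> ?D \<Longrightarrow> (i + 1, j + 1) \<in> ?D \<Longrightarrow> T (i, j) < T (i + 1, j + 1)"
      and T4: "\<And>k. k \<in> {1..n} \<Longrightarrow> T (k, k) = Plain k \<or> T (k, k) = Bar k"
      by (auto simp: symplectic_shifted_tableaux_def)
    show "tab (rk T) = T"
    proof
      fix z :: "nat \<times> nat"
      obtain i j where z: "z = (i, j)" by force
      show "tab (rk T) z = T z"
      proof (cases "(i, j) \<in> ?D")
        case True
        then obtain i' d where "i = Suc i'" "j = Suc (i' + d)" "d < ?l i'" using D_cases by blast
        then show ?thesis using z by (simp add: tabD rkD letter_of_rank)
      next
        case False
        then show ?thesis using z TE PiE_arb[OF TE, of z] by (simp add: tab_def)
      qed
    qed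
    show "rk T \<in> fillings True starts_on_diagonal (2 * n + 1) ?l"
      unfolding fillings_def mem_Collect_eq
    proof (intro conjI allI impI, goal_cases)
      case (1 i d)
      then show ?case using PiE_mem[OF TE, of "(Suc i, Suc (i + d))"] D[of i d] by (simp add: rkD alphabet_iff)
    next
      case (2 i d)
      then show ?case using T4[of "Suc i"] lt[of d i] by (auto simp: rkD starts_on_diagonal_def)
    next
      case (4 i d)
      then show ?case using T1[of "Suc i" "Suc (i + d)"] D[of i d] D[of i "Suc d"] by (simp add: rkD less_eq_letter_def)
    next
      case (5 i d)
      then show ?case using T3[of "Suc i" "Suc (i + d)"] D[of i d] D[of "Suc i" d] dlt[OF 5] by (simp add: rkD less_letter_def)
    next
      case (6 i d)
      then show ?case using T2[of "Suc i" "Suc (i + Suc d)"] D[of i "Suc d"] D[of "Suc i" d] by (simp add: rkD less_eq_letter_def)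
    qed (auto simp: rk_def)
    have W: "entry_weight ?D x y T (Suc i, Suc (i + d)) = cell_weight ?a ?b (\<lambda>t. ?a t + ?b t) ?l (rk T) i d"
      if d: "d < ?l i" for i d
    proof (cases d)
      case 0
      \<comment> \<open>A diagonal box has neither a left neighbour nor a box below it, in
        accordance with the test \<open>0 < d\<close> in \<open>cell_weight\<close>.\<close>
      have "(Suc i, i) \<notin> ?D" "(Suc (Suc i), Suc i) \<notin> ?D" by (auto simp: shifted_diagram_def)
      then show ?thesis using 0 d by (simp add: entry_weight_def cell_weight_def rkD letter_of_rank)
    next
      case (Suc e)
      have "(Suc i, Suc (i + e)) \<in> ?D" using D[of i e] d Suc by simp
      moreover have "(Suc (Suc i), Suc (Suc (i + e))) \<in> ?D \<longleftrightarrow> e < ?l (Suc i)" using D[of "Suc i" e] by simp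
      ultimately show ?thesis using Suc d
        by (auto simp: entry_weight_def cell_weight_def rkD letter_of_rank letter_rank_inject)
    qed
    have "(\<Prod>b\<in>?D. entry_weight ?D x y T b) =
        (\<Prod>(i, d)\<in>Sigma {..<n} (\<lambda>i. {..<?l i}). entry_weight ?D x y T (Suc i, Suc (i + d)))"
      by (subst (1) image, subst prod.reindex) (auto simp: inj_on_def intro!: prod.cong)
    also have "\<dots> = (\<Prod>i<n. \<Prod>d<?l i. entry_weight ?D x y T (Suc i, Suc (i + d)))"
      by (rule prod.Sigma[symmetric]) auto
    also have "\<dots> = (\<Prod>i<n. \<Prod>d<?l i. cell_weight ?a ?b (\<lambda>t. ?a t + ?b t) ?l (rk T) i d)"
      by (intro prod.cong refl) (simp add: W)
    finally show "(\<Prod>i<n. \<Prod>d<?l i. cell_weight ?a ?b (\<lambda>t. ?a t + ?b t) ?l (rk T) i d) =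
        (\<Prod>b\<in>?D. entry_weight ?D x y T b)" ..
  next
    fix U assume U: "U \<in> fillings True starts_on_diagonal (2 * n + 1) ?l"
    then have U1: "\<And>i d. d < ?l i \<Longrightarrow> U i d \<le> 2 * n + 1"
      and U0: "\<And>i d. \<not> d < ?l i \<Longrightarrow> U i d = 0"
      and U2: "\<And>i d. Suc d < ?l i \<Longrightarrow> U i d \<le> U i (Suc d)"
      and U3: "\<And>i d. d < ?l (Suc i) \<Longrightarrow> U i d < U (Suc i) d"
      and U4: "\<And>i d. Suc d < ?l i \<Longrightarrow> d < ?l (Suc i) \<Longrightarrow> U i (Suc d) \<le> U (Suc i) d"
      and U5: "\<And>i. 0 < ?l i \<Longrightarrow> U i 0 = 2 * i + 2 \<or> U i 0 = 2 * i + 3"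
      by (auto simp: fillings_def starts_on_diagonal_def)
    \<comment> \<open>Only the diagonal entries are bounded below directly; the bound spreads along
      the weakly increasing row.\<close>
    have U6: "2 \<le> U i d" if "d < ?l i" for i d
      using fillings_row_mono[OF U, of 0 d i] U5[of i] that by auto
    show "rk (tab U) = U"
    proof (intro ext)
      fix i d show "rk (tab U) i d = U i d"
        using U0[of d i] tabD[of d i U] by (auto simp: rk_def letter_rank_of)
    qed
    show "tab U \<in> symplectic_shifted_tableaux n la"
      unfolding symplectic_shifted_tableaux_def mem_Collect_eq
    proof (intro conjI allI impI ballI)
      show "tab U \<in> ?D \<rightarrow>\<^sub>E alphabet n"
      proof (rule PiE_I)
        fix z assume z: "z \<in> ?D"
        obtain i j where ij: "z = (i, j)" by force
        then obtain i' d where "i = Suc i'" "j = Suc (i' + d)" "d < ?l i'" using D_cases z by blast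
        then show "tab U z \<in> alphabet n" using ij U1[of d i'] U6[of d i'] by (simp add: tabD letter_of_alphabet)
      qed (auto simp: tab_def)
    next
      fix i j assume *: "(i, j) \<in> ?D \<and> (i, j + 1) \<in> ?D"
      then obtain i' d where "i = Suc i'" "j = Suc (i' + d)" "d < ?l i'" using D_cases by blast
      then show "tab U (i, j) \<le> tab U (i, j + 1)"
        using * U2[of d i'] D[of i' "Suc d"] tabD[of "Suc d" i' U] by (simp add: tabD less_eq_letter_def letter_rank_of)
    next
      fix i j assume *: "(i, j) \<in> ?D \<and> (i + 1, j) \<in> ?D"
      then obtain i' d where id: "i = Suc i'" "j = Suc (i' + d)" "d < ?l i'" using D_cases by blast
      \<comment> \<open>A box that has a box below it is not on the diagonal.\<close>
      then obtain e where e: "d = Suc e" using * by (cases d) (auto simp: shifted_diagram_def)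
      then show "tab U (i, j) \<le> tab U (i + 1, j)"
        using * id U4[of e i'] D[of "Suc i'" e] tabD[of e "Suc i'" U] tabD[of d i' U]
        by (simp add: less_eq_letter_def letter_rank_of)
    next
      fix i j assume *: "(i, j) \<in> ?D \<and> (i + 1, j + 1) \<in> ?D"
      then obtain i' d where "i = Suc i'" "j = Suc (i' + d)" "d < ?l i'" using D_cases by blast
      then show "tab U (i, j) < tab U (i + 1, j + 1)"
        using * U3[of d i'] D[of "Suc i'" d] tabD[of d "Suc i'" U] by (simp add: tabD less_letter_def letter_rank_of)
    next
      fix k assume "k \<in> {1..n}"
      then obtain i where i: "k = Suc i" "i < n" by (cases k) auto
      show "tab U (k, k) = Plain k \<or> tab U (k, k) = Bar k"
        using tabD[of 0 i U] pos[of i] U5[of i] i by (auto simp: letter_of_def)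
    qed
  qed
qed

section \<open>The triangular product, the vanishing parts of a partition, and the
  conclusion\<close>

lemma prod_triangle_reindex:
  fixes g :: "nat \<Rightarrow> nat \<Rightarrow> 'a::comm_monoid_mult"
  shows "(\<Prod>i\<in>{1..n}. \<Prod>j\<in>{i..n}. g i j) = (\<Prod>s<n. \<Prod>r\<le>s. g (Suc r) (Suc s))"
proof (induction n)
  case (Suc n)
  \<comment> \<open>Passing to \<open>Suc n\<close> adds the column \<open>j = Suc n\<close> of the
    triangle, just as the determinantal induction adds the factors of one \<open>y\<close>-index at
    a time.\<close>
  have "(\<Prod>i\<in>{1..Suc n}. \<Prod>j\<in>{i..Suc n}. g i j) = (\<Prod>i\<in>{1..Suc n}. (\<Prod>j\<in>{i..n}. g i j) * g i (Suc n))"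
    by (intro prod.cong refl) (auto simp: atLeastAtMostSuc_conv mult.commute)
  also have "\<dots> = (\<Prod>i\<in>{1..n}. \<Prod>j\<in>{i..n}. g i j) * (\<Prod>i\<in>{1..Suc n}. g i (Suc n))"
    by (simp add: prod.distrib mult_ac)
  also have "(\<Prod>i\<in>{1..Suc n}. g i (Suc n)) = (\<Prod>r\<le>n. g (Suc r) (Suc n))"
    by (rule prod.reindex_bij_witness[where i = Suc and j = "\<lambda>i. i - 1"]) auto
  finally show ?case using Suc.IH by simp
qed simp

text \<open>A positive part \<open>\<mu> i\<close> would make all of the parts 1 to \<open>i\<close>
  positive, so the length would exceed \<open>n\<close>.\<close>

lemma partition_eq_0:
  assumes "is_partition \<mu>" "partition_length \<mu> \<le> n" "n < i"
  shows "\<mu> i = 0"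
proof (rule ccontr)
  assume i: "\<mu> i \<noteq> 0"
  have mono: "\<mu> k \<le> \<mu> j" if "1 \<le> j" "j \<le> k" for j k
    using that(2)
  proof (induction rule: dec_induct)
    case (step m)
    then have "\<mu> (m + 1) \<le> \<mu> m" using assms(1) that(1) by (simp add: is_partition_def)
    then show ?case using step by simp
  qed simp
  have "{1..i} \<subseteq> {j. 1 \<le> j \<and> \<mu> j > 0}" using mono[of _ i] i by (auto intro: less_le_trans)
  moreover have "finite {j. 1 \<le> j \<and> \<mu> j > 0}" using assms(1) by (simp add: is_partition_def)
  ultimately have "card {1..i} \<le> partition_length \<mu>" unfolding partition_length_def by (rule card_mono[rotated])
  then show False using assms(2,3) by simp
qed

theorem theorem3:
  fixes n :: nat and \<mu> :: "nat \<Rightarrow> nat" and x y :: "nat \<Rightarrow> 'a::field"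
  assumes "n \<ge> 1"
    and "is_partition \<mu>"
    and "partition_length \<mu> \<le> n"
    and "\<And>k. k \<in> {1..n} \<Longrightarrow> x k \<noteq> 0"
    and "\<And>k. k \<in> {1..n} \<Longrightarrow> y k \<noteq> 0"
  shows "shifted_tableaux_sum n (\<lambda>i. \<mu> i + staircase n i) x y =
    (\<Prod>i\<in>{1..n}. \<Prod>j\<in>{i..n}. (x i + y j) * (1 + inverse (x i) * inverse (y j)))
      * symplectic_character n \<mu> x"
proof -
  let ?a = "\<lambda>t. letter_weight x (letter_of t)" and ?b = "\<lambda>t. letter_weight y (letter_of t)"
  let ?l = "\<lambda>i. \<mu> (Suc i) + staircase n (Suc i)"
  let ?det = "det (mat n n (\<lambda>(i, j). column_series x n j $ (\<mu> (Suc i) + (n - i))))"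
  have dec: "\<mu> (Suc (Suc i)) \<le> \<mu> (Suc i)" for i
    using assms(2) unfolding is_partition_def by force
  have z: "\<mu> (Suc i) = 0" if "n \<le> i" for i
    using partition_eq_0[OF assms(2,3), of "Suc i"] that by simp
  have x: "x (Suc r) \<noteq> 0" and y: "y (Suc r) \<noteq> 0" if "r < n" for r
    using assms(4,5)[of "Suc r"] that by auto
  have letters: "letter_of (2 * r + 2) = Plain (Suc r)" "letter_of (2 * r + 3) = Bar (Suc r)" for r
    by (auto simp: letter_of_def)
  have stair: "staircase n (Suc i) = n - i" for i
    by (auto simp: staircase_def)
  have "symplectic_character n \<mu> x = filling_sum ?a ?a ?a False symplectic_bound n (2 * n + 1) (\<lambda>i. \<mu> (Suc i))"
    by (rule symplectic_character_eq_filling_sum) (use z dec in auto)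
  also have "\<dots> = ?det"
    by (rule symplectic_filling_sum_det) (use x z dec letters in auto)
  finally have sp: "symplectic_character n \<mu> x = ?det" .
  have "shifted_tableaux_sum n (\<lambda>i. \<mu> i + staircase n i) x y =
      filling_sum ?a ?b (\<lambda>t. ?a t + ?b t) True starts_on_diagonal n (2 * n + 1) ?l"
    by (rule shifted_tableaux_sum_eq_filling_sum)
      (use z dec in \<open>auto simp: stair intro!: add_mono diff_le_mono2\<close>)
  also have "\<dots> = (\<Prod>s<n. \<Prod>r\<le>s. x (Suc r) + inverse (x (Suc r)) + y (Suc s) + inverse (y (Suc s))) *
      det (mat n n (\<lambda>(i, j). column_series x n j $ ?l i))"
  proof (rule shifted_filling_sum_det)
    fix i assume "i < n"
    then show "?l (Suc i) < ?l i" using dec[of i] by (simp add: stair)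
  qed (use x y z letters in \<open>auto simp: stair\<close>)
  \<comment> \<open>Because \<open>staircase n (Suc i) = n - i\<close>, the determinant is the one
    found for the symplectic character. The factors agree since
    \<open>(x + y) (1 + 1/(x y)) = x + 1/x + y + 1/y\<close>.\<close>
  also have "\<dots> = (\<Prod>s<n. \<Prod>r\<le>s. (x (Suc r) + y (Suc s)) * (1 + inverse (x (Suc r)) * inverse (y (Suc s)))) * ?det"
    unfolding stair
    by (intro arg_cong2[where f = "(*)"] prod.cong refl) (use x y in \<open>auto simp: field_simps\<close>)
  finally show ?thesis unfolding sp prod_triangle_reindex .
qed

end
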